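(* Let $\{\lambda_n\}_{n\ge1}$ be an admissible scale. For $v\in\mathbb{R}$ and each $n$ put $z=e^{2\pi v}$ and $q=e^{-\pi\lambda_n^{-1}}$. Then $$A_q(-q^{-4n}z)=\exp\left\{\pi\lambda_n\left(v+\frac{2n}{\lambda_n}\right)^2+\frac{\pi\lambda_n}{6}-\frac{\pi}{24\lambda_n}\right\}\frac{1}{\sqrt2}\left\{1+\mathcal{O}\left(e^{-\pi\lambda_n}\right)\right\}$$ and $$A_q(q^{-4n}z)=\exp\left\{\pi\lambda_n\left(v+\frac{2n}{\lambda_n}\right)^2-\frac{\pi\lambda_n}{12}-\frac{\pi}{24\lambda_n}\right\}\sqrt2\left\{\cos\pi\lambda_nv+\mathcal{O}\left(e^{-2\pi\lambda_n}\right)\right\}$$ as $n\to\infty$, where the $\mathcal{O}$-terms are uniform for $v$ in any compact subset of $\mathbb{R}$.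
   Context: An admissible scale is a sequence $\{\lambda_n\}_{n=1}^\infty$ of positive numbers with $\lim_{n\to\infty}\lambda_n/\log n=\infty$ and $\lim_{n\to\infty}n/\lambda_n^2=\infty$. For $0<q<1$, $(x;q)_\infty=\prod_{k=0}^\infty(1-xq^k)$ and $(x;q)_k=(x;q)_\infty/(xq^k;q)_\infty$. Ramanujan's entire function ($q$-Airy function) is $$A_q(w)=\frac{1}{(q;q)_\infty}\sum_{k=0}^\infty (q^{k+1};q)_\infty q^{k^2}(-w)^k=\sum_{k=0}^\infty\frac{q^{k^2}(-w)^k}{(q;q)_k}.$$ Note that $q$ depends on $n$. Uniformity on compacts means: for each compact $K\subset\mathbb{R}$ there are $C,N$ such that the error term is bounded in absolute value by $C$ times the indicated quantity for all $n\ge N$ and $v\in K$. *)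

theory Defs
  imports "HOL-Analysis.Analysis"
begin

definition admissible_scale :: "(nat \<Rightarrow> real) \<Rightarrow> bool" where
  "admissible_scale l \<longleftrightarrow>
     (\<forall>n\<ge>1. l n > 0) \<and>
     filterlim (\<lambda>n. l n / ln (real n)) at_top sequentially \<and>
     filterlim (\<lambda>n. real n / (l n)\<^sup>2) at_top sequentially"

definition qpoch_inf :: "'a \<Rightarrow> 'a \<Rightarrow> 'a :: {real_normed_field, banach}" where
  "qpoch_inf x q = (\<Prod>k. 1 - x * q ^ k)"

text \<open>Ramanujan's entire function $A_q(w)$, for $0 < q < 1$. It is stated polymorphically,
  so that it covers both complex and real arguments.\<close>

definition ramanujan_Aq :: "'a \<Rightarrow> 'a \<Rightarrow> 'a :: {real_normed_field, banach}" where
  "ramanujan_Aq q w =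
     1 / qpoch_inf q q * (\<Sum>k. qpoch_inf (q ^ (k + 1)) q * q ^ (k\<^sup>2) * (- w) ^ k)"

text \<open>The constants \<open>C\<close> and \<open>N\<close> may depend on the compact set \<open>K\<close> but not on the point \<open>v\<close>.\<close>

definition bigo_unif_compacts :: "(nat \<Rightarrow> real \<Rightarrow> real) \<Rightarrow> (nat \<Rightarrow> real) \<Rightarrow> bool" where
  "bigo_unif_compacts E g \<longleftrightarrow>
     (\<forall>K. compact K \<longrightarrow> (\<exists>C N. \<forall>n\<ge>N. \<forall>v\<in>K. \<bar>E n v\<bar> \<le> C * g n))"

end

theory Submission
  imports Defs "HOL-Probability.Characteristic_Functions" "HOL-Library.Nat_Bijection"
begin

text \<open>
  Completing the square turns \<open>A\<^sub>q(\<mp>q\<^bsup>-4n\<^esup>z)\<close> into \<open>exp (\<pi>\<lambda>(v + 2n/\<lambda>)\<^sup>2) / (q;q)\<^sub>\<infinity>\<close> times the sum over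
  \<open>k \<ge> 0\<close> of \<open>(\<plusminus>1)\<^sup>k (q\<^bsup>k+1\<^esup>;q)\<^sub>\<infinity> exp (-\<pi>(X - k)\<^sup>2/\<lambda>)\<close> with \<open>X = 2n + \<lambda>v\<close>. Since \<open>n/\<lambda>\<^sup>2 \<rightarrow> \<infinity>\<close>, replacing the
  \<open>q\<close>-Pochhammer factors by 1 and extending the sum to all integers costs less than the allowed error.
  Poisson summation for Gaussians then evaluates the remaining theta sums. The denominator \<open>(q;q)\<^sub>\<infinity>\<close>
  is itself an alternating Gaussian sum by Euler's pentagonal number theorem, so that the same Poisson
  formula replaces the modular transformation of Dedekind's eta function.
\<close>

subsection \<open>Completeness of the cosines\<close>

text \<open>The alternating sum sets the precision. Its terms cancel down to size
  \<open>sqrt l * exp (- pi * l / 4)\<close>, and the error must be smaller by a further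
  \<open>exp (- 2 * pi * l)\<close>, so the passage to the two-sided sum has to be accurate to
  \<open>exp (- 9 / 4 * pi * l)\<close> relative to \<open>sqrt l\<close>; the estimates provide
  \<open>exp (- 3 * pi * l)\<close>. The main cost is \<open>q ^ n = exp (- pi * n / l)\<close>, so
  \<open>n\<close> has to exceed a multiple of \<open>l\<^sup>2\<close>, here
  \<open>8 * l\<^sup>2 \<le> n\<close>. Estimates are stated for independent \<open>l\<close>,
  \<open>v\<close>, \<open>n\<close> with the constants quantified before them, so uniformity in
  \<open>v\<close> can be read off the quantifiers and the scale enters only at the end. One
  truncation estimate for dual series serves the plain sum, the alternating sum and Euler's
  product.\<close>

lemma integral_cos_power_vanish:
  fixes h :: "real \<Rightarrow> real" and m :: int
  assumes cont: "continuous_on {0..1} h"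
    and coeff: "\<And>m::int. integral {0..1} (\<lambda>x. h x * cos (2 * pi * m * x)) = 0"
  shows "integral {0..1} (\<lambda>x. h x * cos (2 * pi * x) ^ n * cos (2 * pi * m * x)) = 0"
proof (induction n arbitrary: m)
  case 0
  then show ?case using coeff by simp
next
  case (Suc n)
  \<comment> \<open>Product-to-sum trades one cosine factor for the frequencies \<open>m + 1\<close>
    and \<open>m - 1\<close>, so the induction hypothesis has to cover every
    \<open>m\<close>.\<close>
  have "h x * cos (2 * pi * x) ^ Suc n * cos (2 * pi * m * x)
      = (1/2) * (h x * cos (2 * pi * x) ^ n * cos (2 * pi * of_int (m + 1) * x)
                + h x * cos (2 * pi * x) ^ n * cos (2 * pi * of_int (m - 1) * x))" for x
    by (simp add: algebra_simps cos_add cos_diff)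
  moreover have "(\<lambda>x. h x * cos (2 * pi * x) ^ n * cos (2 * pi * of_int k * x)) integrable_on {0..1}"
    for k :: int
    by (intro integrable_continuous_interval continuous_intros cont)
  ultimately show ?case
    by (simp only: integral_mult_right integral_add Suc.IH) simp
qed

text \<open>Even periodic functions are functions of \<open>y = cos (2\<pi>x)\<close>, so completeness of the cosines
  reduces to polynomial approximation in \<open>y\<close>.\<close>

lemma cosine_coefficients_unique:
  fixes h :: "real \<Rightarrow> real"
  assumes cont: "continuous_on {0..1} h"
    and sym: "\<And>x. x \<in> {0..1} \<Longrightarrow> h (1 - x) = h x"
    and coeff: "\<And>m::int. integral {0..1} (\<lambda>x. h x * cos (2 * pi * m * x)) = 0"
    and x: "x \<in> {0..1}"
  shows "h x = 0"
proof -
  \<comment> \<open>\<open>arccos\<close> inverts \<open>cos (2 * pi * t)\<close> for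
    \<open>t \<le> 1/2\<close> only; on the other half the symmetry of \<open>h\<close> makes
    \<open>H\<close> agree with \<open>h\<close>.\<close>
  define H where "H y = h (arccos y / (2 * pi))" for y
  have H: "H (cos (2 * pi * t)) = h t" if "t \<in> {0..1}" for t
  proof (cases "t \<le> 1/2")
    case True
    then have "arccos (cos (2 * pi * t)) = 2 * pi * t"
      using that by (intro arccos_cos) (auto simp: field_simps)
    then show ?thesis by (simp add: H_def)
  next
    case False
    have "cos (2 * pi * t) = cos (2 * pi * (1 - t))"
      by (simp add: algebra_simps cos_diff)
    moreover have "arccos (cos (2 * pi * (1 - t))) = 2 * pi * (1 - t)"
      using that False by (intro arccos_cos) (auto simp: field_simps)
    ultimately show ?thesis using sym that by (simp add: H_def)
  qed
  have contH: "continuous_on {-1..1} H"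
    unfolding H_def
  proof (rule continuous_on_compose2[OF cont])
    show "continuous_on {-1..1} (\<lambda>y. arccos y / (2 * pi))"
      by (intro continuous_intros) auto
    show "(\<lambda>y. arccos y / (2 * pi)) ` {-1..1} \<subseteq> {0..1}"
    proof safe
      fix y :: real assume "y \<in> {-1..1}"
      then have "0 \<le> arccos y" "arccos y \<le> pi" by (auto intro: arccos_lbound arccos_ubound)
      then show "arccos y / (2 * pi) \<in> {0..1}" by (auto simp: field_simps)
    qed
  qed
  let ?I = "integral {0..1} (\<lambda>t. (h t)\<^sup>2)"
  define B where "B = integral {0..1} (\<lambda>t. \<bar>h t\<bar>)"
  have B0: "B \<ge> 0"
    unfolding B_def by (intro integral_nonneg integrable_continuous_interval continuous_intros cont) auto
  \<comment> \<open>\<open>h\<close> is orthogonal to every polynomial in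
    \<open>cos (2 * pi * t)\<close>, so in the integral of \<open>h\<^sup>2\<close> one factor may
    be replaced by its approximation error, which is below \<open>e\<close>.\<close>
  have le: "?I \<le> e * B" if e: "e > 0" for e
  proof -
    obtain g where g: "real_polynomial_function g" "\<And>y. y \<in> {-1..1} \<Longrightarrow> \<bar>H y - g y\<bar> < e"
      using Stone_Weierstrass_real_polynomial_function[OF _ contH e] by auto
    then obtain a N where gs: "g = (\<lambda>y. \<Sum>i\<le>N. a i * y ^ i)"
      by (auto simp: real_polynomial_function_iff_sum)
    have contg: "continuous_on {0..1} (\<lambda>t. g (cos (2 * pi * t)))"
      unfolding gs by (intro continuous_intros)
    have "integral {0..1} (\<lambda>t. h t * cos (2 * pi * t) ^ i) = 0" for i
      using integral_cos_power_vanish[OF cont coeff, of i 0] by simp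
    moreover have "(\<lambda>t. h t * g (cos (2 * pi * t)))
        = (\<lambda>t. \<Sum>i\<le>N. a i * (h t * cos (2 * pi * t) ^ i))"
      by (simp add: gs sum_distrib_left algebra_simps)
    ultimately have "integral {0..1} (\<lambda>t. h t * g (cos (2 * pi * t))) = 0"
      by (simp, subst integral_sum)
        (auto intro!: integrable_continuous_interval continuous_intros cont)
    then have "?I = integral {0..1} (\<lambda>t. (h t)\<^sup>2 - h t * g (cos (2 * pi * t)))"
      by (subst integral_diff) (auto intro!: integrable_continuous_interval continuous_intros cont contg)
    also have "\<dots> \<le> integral {0..1} (\<lambda>t. e * \<bar>h t\<bar>)"
    proof (rule integral_le)
      fix t :: real assume t: "t \<in> {0..1}"
      have "\<bar>h t - g (cos (2 * pi * t))\<bar> \<le> e"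
        using g(2)[of "cos (2 * pi * t)"] H[OF t] by simp
      then have "\<bar>h t\<bar> * \<bar>h t - g (cos (2 * pi * t))\<bar> \<le> \<bar>h t\<bar> * e"
        by (intro mult_left_mono) auto
      moreover have "(h t)\<^sup>2 - h t * g (cos (2 * pi * t)) \<le> \<bar>h t * (h t - g (cos (2 * pi * t)))\<bar>"
        by (simp add: power2_eq_square algebra_simps)
      ultimately show "(h t)\<^sup>2 - h t * g (cos (2 * pi * t)) \<le> e * \<bar>h t\<bar>"
        by (simp add: abs_mult mult.commute)
    qed (intro integrable_continuous_interval continuous_intros cont contg)+
    finally show ?thesis by (simp add: B_def)
  qed
  have "?I \<le> 0"
  proof (rule field_le_epsilon)
    fix e :: real assume "e > 0"
    \<comment> \<open>Dividing by \<open>B + 1\<close> also covers \<open>B = 0\<close>.\<close>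
    then have "?I \<le> e / (B + 1) * B" using B0 by (intro le) auto
    also have "\<dots> \<le> e" using B0 \<open>e > 0\<close> by (simp add: field_simps)
    finally show "?I \<le> 0 + e" by simp
  qed
  moreover have "?I \<ge> 0"
    by (intro integral_nonneg integrable_continuous_interval continuous_intros cont) auto
  ultimately have "\<forall>t\<in>{0..1}. (h t)\<^sup>2 = 0"
    by (subst integral_eq_0_iff[symmetric]) (auto intro!: continuous_intros cont)
  with x show ?thesis by simp
qed

subsection \<open>Poisson summation for Gaussians\<close>

text \<open>The substitution \<open>c * x\<close> with \<open>c = sqrt (2 * a)\<close> reduces the
  integral to the characteristic function of the standard normal law at
  \<open>t / c\<close>.\<close>

lemma gaussian_cos_integral:
  fixes a t :: real
  assumes a: "a > 0"
  shows "has_bochner_integral lborel (\<lambda>x. exp (- a * x\<^sup>2) * cos (t * x))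
           (sqrt (pi / a) * exp (- t\<^sup>2 / (4 * a)))"
proof -
  define c where "c = sqrt (2 * a)"
  have c: "c > 0" "c\<^sup>2 = 2 * a" using a by (auto simp: c_def)
  have i1: "integrable lborel (\<lambda>x. std_normal_density x * cos (s * x))" for s
    by (rule Bochner_Integration.integrable_bound[OF integrable_normal_density[of 1 0]])
       (auto simp: abs_mult mult_left_le)
  have e1: "(LINT x|lborel. std_normal_density x * cos (s * x)) = exp (- s\<^sup>2 / 2)" for s
  proof -
    have "complex_of_real (exp (- (s^2) / 2)) = char std_normal_distribution s"
      by (simp add: char_std_normal_distribution)
    also have "\<dots> = (CLINT x|lborel. std_normal_density x *\<^sub>R iexp (s * x))"
      unfolding char_def by (subst integral_density) auto
    finally have "exp (- (s^2) / 2) = Re (CLINT x|lborel. std_normal_density x *\<^sub>R iexp (s * x))"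
      by (metis Re_complex_of_real)
    also have "\<dots> = (LINT x|lborel. Re (std_normal_density x *\<^sub>R iexp (s * x)))"
    proof (rule integral_Re[symmetric])
      show "complex_integrable lborel (\<lambda>x. std_normal_density x *\<^sub>R iexp (s * x))"
        by (rule Bochner_Integration.integrable_bound[OF integrable_normal_density[of 1 0]]) auto
    qed
    also have "\<dots> = (LINT x|lborel. std_normal_density x * cos (s * x))"
      by (simp add: Re_exp)
    finally show ?thesis by simp
  qed
  have eq: "std_normal_density (0 + c * x) * cos (t / c * (0 + c * x))
      = (1 / sqrt (2 * pi)) * (exp (- a * x\<^sup>2) * cos (t * x))" for x
    using c by (simp add: std_normal_density_def power_mult_distrib)
  have "integrable lborel (\<lambda>x. (1 / sqrt (2 * pi)) * (exp (- a * x\<^sup>2) * cos (t * x)))"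
    using lborel_integrable_real_affine[OF i1[of "t / c"], of c 0] c unfolding eq by simp
  then have I: "integrable lborel (\<lambda>x. exp (- a * x\<^sup>2) * cos (t * x))"
    unfolding integrable_mult_left_iff by simp
  have "exp (- (t / c)\<^sup>2 / 2) = c * (1 / sqrt (2 * pi)) * (LINT x|lborel. exp (- a * x\<^sup>2) * cos (t * x))"
    using lborel_integral_real_affine[of c "\<lambda>x. std_normal_density x * cos (t / c * x)" 0] c
    unfolding eq e1 by simp
  moreover have "(t / c)\<^sup>2 / 2 = t\<^sup>2 / (4 * a)"
    using c by (simp add: power_divide)
  moreover have "sqrt (pi / a) * (c * (1 / sqrt (2 * pi))) = 1"
    using a by (simp add: c_def real_sqrt_mult real_sqrt_divide)
  ultimately have "(LINT x|lborel. exp (- a * x\<^sup>2) * cos (t * x)) = sqrt (pi / a) * exp (- t\<^sup>2 / (4 * a))"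
    using a c by (simp add: field_simps)
  with I show ?thesis by (simp add: has_bochner_integral_iff)
qed

section \<open>Gaussian series over the integers: majorants and termwise integration\<close>

lemma summable_on_exp_minus_abs: "(\<lambda>j::int. exp (- \<bar>real_of_int j\<bar>)) summable_on UNIV"
proof -
  have "summable (\<lambda>n. exp (- 1 :: real) ^ n)"
    by (rule summable_geometric) simp
  then have "(\<lambda>n::nat. exp (- real n)) summable_on UNIV"
    by (intro norm_summable_imp_summable_on) (simp add: exp_of_nat_mult[symmetric])
  then have *: "(\<lambda>j::int. exp (- \<bar>real_of_int j\<bar>)) summable_on (range int)"
    "(\<lambda>j::int. exp (- \<bar>real_of_int j\<bar>)) summable_on (range (\<lambda>n. - int n))"
    by (subst summable_on_reindex; auto simp: o_def inj_on_def)+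
  have "(UNIV :: int set) = range int \<union> range (\<lambda>n. - int n)"
  proof -
    have "j \<in> range int \<union> range (\<lambda>n. - int n)" for j
      by (cases j rule: int_cases2) auto
    then show ?thesis by auto
  qed
  with summable_on_union[OF *] show ?thesis by simp
qed

text \<open>Completing the square in \<open>\<bar>x - j\<bar>\<close> bounds the quadratic below by
  a linear function at the price of \<open>1 / (4 * a)\<close>. The bound is the same for all
  \<open>x\<close> in \<open>[- R, R]\<close>, hence a Weierstrass majorant.\<close>

lemma exp_gaussian_le:
  fixes a x R :: real and j :: int
  assumes "a > 0" "\<bar>x\<bar> \<le> R"
  shows "exp (- a * (x - j)\<^sup>2) \<le> exp (R + 1 / (4 * a)) * exp (- \<bar>real_of_int j\<bar>)"
proof -
  have "0 \<le> a * (\<bar>x - j\<bar> - 1 / (2 * a))\<^sup>2" using assms by simp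
  also have "\<dots> = a * (x - j)\<^sup>2 - \<bar>x - j\<bar> + 1 / (4 * a)"
    using assms by (simp add: power2_diff power_divide) (simp add: field_simps power2_eq_square)
  finally have "a * (x - j)\<^sup>2 \<ge> \<bar>real_of_int j\<bar> - R - 1 / (4 * a)" using assms by linarith
  then show ?thesis by (simp flip: exp_add)
qed

lemma summable_on_gaussian:
  fixes a x :: real
  assumes "a > 0"
  shows "(\<lambda>j::int. exp (- a * (x - j)\<^sup>2)) summable_on UNIV"
  by (rule summable_on_comparison_test[OF summable_on_cmult_right[OF summable_on_exp_minus_abs]],
      rule exp_gaussian_le[OF assms, of x "\<bar>x\<bar>"]) auto

text \<open>The M-test gives uniform convergence along the filter of finite index sets; both
  conclusions then follow from limit theorems for uniform limits.\<close>

lemma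
  fixes f :: "'a \<Rightarrow> real \<Rightarrow> real"
  assumes cont: "\<And>j. continuous_on {a..b} (f j)"
    and le: "\<And>j x. x \<in> {a..b} \<Longrightarrow> \<bar>f j x\<bar> \<le> M j"
    and M: "M summable_on UNIV"
  shows continuous_on_infsum: "continuous_on {a..b} (\<lambda>x. \<Sum>\<^sub>\<infinity>j. f j x)"
    and has_sum_integral_infsum:
      "((\<lambda>j. integral {a..b} (f j)) has_sum integral {a..b} (\<lambda>x. \<Sum>\<^sub>\<infinity>j. f j x)) UNIV"
proof -
  have u: "uniform_limit {a..b} (\<lambda>F x. \<Sum>j\<in>F. f j x) (\<lambda>x. \<Sum>\<^sub>\<infinity>j. f j x) (finite_subsets_at_top UNIV)"
    using Weierstrass_m_test_general[of UNIV "{a..b}" f M] le M by auto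
  have c: "continuous_on {a..b} (\<lambda>x. \<Sum>j\<in>F. f j x)" for F
    by (intro continuous_intros cont)
  show "continuous_on {a..b} (\<lambda>x. \<Sum>\<^sub>\<infinity>j. f j x)"
    by (rule uniform_limit_theorem[OF _ u]) (auto intro: always_eventually c)
  obtain I J where IJ: "\<And>F. ((\<lambda>x. \<Sum>j\<in>F. f j x) has_integral I F) {a..b}"
    "((\<lambda>x. \<Sum>\<^sub>\<infinity>j. f j x) has_integral J) {a..b}" "(I \<longlongrightarrow> J) (finite_subsets_at_top UNIV)"
    by (rule uniform_limit_integral[OF u c]) auto
  have "(\<Sum>j\<in>F. integral {a..b} (f j)) = I F" if "finite F" for F
  proof -
    have "((\<lambda>x. \<Sum>j\<in>F. f j x) has_integral (\<Sum>j\<in>F. integral {a..b} (f j))) {a..b}"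
      by (intro has_integral_sum that integrable_integral integrable_continuous_interval cont)
    with IJ(1)[of F] show ?thesis by (simp add: has_integral_unique)
  qed
  then have "((\<lambda>F. \<Sum>j\<in>F. integral {a..b} (f j)) \<longlongrightarrow> J) (finite_subsets_at_top UNIV)"
    by (intro Lim_transform_eventually[OF IJ(3)]) (auto intro!: eventually_finite_subsets_at_top_weakI)
  then show "((\<lambda>j. integral {a..b} (f j)) has_sum integral {a..b} (\<lambda>x. \<Sum>\<^sub>\<infinity>j. f j x)) UNIV"
    using IJ(2) by (simp add: has_sum_def integral_unique)
qed

text \<open>Turns unordered sums into limits of partial sums. Half-open ranges are used because
  their unit intervals \<open>[k, k + 1]\<close> tile \<open>[- N, N]\<close>.\<close>

lemma filterlim_int_interval_finite_subsets:
  "filterlim (\<lambda>N::nat. {- int N..<int N}) (finite_subsets_at_top UNIV) sequentially"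
  unfolding filterlim_finite_subsets_at_top
proof (intro allI impI)
  fix X :: "int set" assume "finite X \<and> X \<subseteq> UNIV"
  then have X: "finite X" by simp
  define N0 where "N0 = nat (\<Sum>x\<in>X. \<bar>x\<bar>) + 1"
  have "X \<subseteq> {- int N..<int N}" if "N \<ge> N0" for N
  proof
    fix x assume "x \<in> X"
    then have "\<bar>x\<bar> \<le> (\<Sum>x\<in>X. \<bar>x\<bar>)" using X by (intro member_le_sum) auto
    then show "x \<in> {- int N..<int N}" using that by (auto simp: N0_def)
  qed
  then show "\<forall>\<^sub>F N in sequentially. finite {- int N..<int N} \<and> X \<subseteq> {- int N..<int N} \<and> {- int N..<int N} \<subseteq> UNIV"
    by (auto simp: eventually_sequentially)
qed

text \<open>\<open>S\<close> and \<open>L\<close> are both limits of the integral over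
  \<open>[- N, N]\<close>: the first by grouping the unordered sum into symmetric ranges, the second
  by the ball characterisation of the gauge integral over the line.\<close>

lemma has_sum_unit_integrals:
  fixes f :: "real \<Rightarrow> real"
  assumes cont: "continuous_on UNIV f" and L: "has_bochner_integral lborel f L"
    and s: "((\<lambda>k::int. integral {of_int k..of_int k + 1} f) has_sum S) UNIV"
  shows "S = L"
proof -
  have int: "f integrable_on {u..v}" for u v
    by (rule integrable_continuous_interval[OF continuous_on_subset[OF cont]]) simp
  have eq: "(\<Sum>k\<in>{- int N..<int N}. integral {of_int k..of_int k + 1} f) = integral {- real N..real N} f" for N
  proof (induction N)
    case (Suc N)
    have "{- int (Suc N)..<int (Suc N)} = insert (- int N - 1) (insert (int N) {- int N..<int N})" by auto
    then have "(\<Sum>k\<in>{- int (Suc N)..<int (Suc N)}. integral {of_int k..of_int k + 1} f)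
       = integral {- real N - 1..- real N} f + integral {real N..real N + 1} f + integral {- real N..real N} f"
      by (simp add: Suc.IH)
    also have "\<dots> = integral {- real N - 1..real N + 1} f"
      using Henstock_Kurzweil_Integration.integral_combine[of "- real N - 1" "- real N" "real N" f]
        Henstock_Kurzweil_Integration.integral_combine[of "- real N - 1" "real N" "real N + 1" f] int
      by (simp add: algebra_simps)
    moreover have "- real (Suc N) = - real N - 1" "real (Suc N) = real N + 1" by auto
    ultimately show ?case by (simp only:)
  qed simp
  have "(\<lambda>N. \<Sum>k\<in>{- int N..<int N}. integral {of_int k..of_int k + 1} f) \<longlonglongrightarrow> S"
    using s filterlim_int_interval_finite_subsets unfolding has_sum_def by (rule filterlim_compose)
  then have 1: "(\<lambda>N. integral {- real N..real N} f) \<longlonglongrightarrow> S" by (simp add: eq)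
  have "(f has_integral L) UNIV"
    using L has_integral_integral_lborel by (metis has_bochner_integral_iff)
  have "(\<lambda>N. integral {- real N..real N} f) \<longlonglongrightarrow> L"
  proof (rule LIMSEQ_I)
    fix e :: real assume "e > 0"
    moreover have "\<forall>e>0. \<exists>B>0. \<forall>a b. ball 0 B \<subseteq> {a..b} \<longrightarrow> \<bar>integral {a..b} f - L\<bar> < e"
      using \<open>(f has_integral L) UNIV\<close> unfolding has_integral_alt' by simp
    ultimately obtain B where B: "B > 0" "\<And>a b. ball 0 B \<subseteq> {a..b} \<Longrightarrow> \<bar>integral {a..b} f - L\<bar> < e"
      by blast
    have "\<bar>integral {- real N..real N} f - L\<bar> < e" if "N \<ge> nat \<lceil>B\<rceil>" for N
      using that by (intro B(2)) (auto simp: dist_real_def)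
    then show "\<exists>no. \<forall>n\<ge>no. norm (integral {- real n..real n} f - L) < e"
      unfolding real_norm_def by blast
  qed
  with 1 show ?thesis using LIMSEQ_unique by blast
qed

section \<open>Cosine coefficients and the Poisson formula\<close>

lemma cos_int_mult_shift: "cos (2 * pi * real_of_int m * (x + real_of_int k)) = cos (2 * pi * m * x)"
proof -
  have "2 * pi * real_of_int m * (x + real_of_int k) = 2 * pi * m * x + 2 * pi * real_of_int (m * k)"
    by (simp add: algebra_simps)
  then show ?thesis by (simp add: cos_add cos_int_2pin sin_int_2pin del: of_int_mult)
qed

text \<open>Unfolding: the cosine has period 1, so the \<open>j\<close>-th term over the unit
  interval is one fixed function over \<open>[- j, - j + 1]\<close>, and these integrals add up to
  the whole-line integral of \<open>gaussian_cos_integral\<close>.\<close>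

lemma gaussian_sum_cos_coefficient:
  fixes a :: real and m :: int
  assumes a: "a > 0"
  shows "integral {0..1} (\<lambda>x. (\<Sum>\<^sub>\<infinity>j::int. exp (- a * (x - j)\<^sup>2)) * cos (2 * pi * m * x))
    = sqrt (pi / a) * exp (- (pi * m)\<^sup>2 / a)"
proof -
  let ?f = "\<lambda>y. exp (- a * y\<^sup>2) * cos (2 * pi * m * y)"
  let ?g = "\<lambda>(j::int) x. exp (- a * (x - j)\<^sup>2) * cos (2 * pi * m * x)"
  have le: "\<bar>?g j x\<bar> \<le> exp (1 + 1 / (4 * a)) * exp (- \<bar>real_of_int j\<bar>)" if "x \<in> {0..1}" for j x
  proof -
    have "\<bar>?g j x\<bar> \<le> exp (- a * (x - j)\<^sup>2)"
      by (simp add: abs_mult mult_left_le)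
    also have "\<dots> \<le> exp (1 + 1 / (4 * a)) * exp (- \<bar>real_of_int j\<bar>)"
      using that a by (intro exp_gaussian_le) auto
    finally show ?thesis .
  qed
  have "((\<lambda>j. integral {0..1} (?g j)) has_sum integral {0..1} (\<lambda>x. \<Sum>\<^sub>\<infinity>j. ?g j x)) UNIV"
    by (rule has_sum_integral_infsum[OF _ le summable_on_cmult_right[OF summable_on_exp_minus_abs]])
       (auto intro!: continuous_intros)
  moreover have "integral {0..1} (?g j) = integral {of_int (- j)..of_int (- j) + 1} ?f" for j
  proof -
    have "(?f has_integral integral {of_int (- j)..of_int (- j) + 1} ?f) {of_int (- j)..of_int (- j) + 1}"
      by (intro integrable_integral integrable_continuous_interval continuous_intros)
    from has_integral_affinity[OF this[unfolded box_real[symmetric]], of 1 "- of_int j"]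
    have "((\<lambda>x. ?f (x - of_int j)) has_integral integral {of_int (- j)..of_int (- j) + 1} ?f) {0..1}"
      by (simp add: image_add_atLeastAtMost algebra_simps)
    moreover have "?f (x - of_int j) = ?g j x" for x
      using cos_int_mult_shift[of m x "- j"] by simp
    ultimately show ?thesis by (simp add: integral_unique)
  qed
  ultimately have "((\<lambda>j::int. integral {of_int (- j)..of_int (- j) + 1} ?f)
      has_sum integral {0..1} (\<lambda>x. \<Sum>\<^sub>\<infinity>j. ?g j x)) UNIV"
    by simp
  then have "((\<lambda>k::int. integral {of_int k..of_int k + 1} ?f)
      has_sum integral {0..1} (\<lambda>x. \<Sum>\<^sub>\<infinity>j. ?g j x)) UNIV"
    using has_sum_reindex_bij_betw[of uminus UNIV UNIV "\<lambda>k::int. integral {of_int k..of_int k + 1} ?f"]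
      bij_uminus by blast
  moreover have "continuous_on UNIV ?f" by (intro continuous_intros)
  ultimately have "integral {0..1} (\<lambda>x. \<Sum>\<^sub>\<infinity>j. ?g j x)
      = sqrt (pi / a) * exp (- (2 * pi * m)\<^sup>2 / (4 * a))"
    using has_sum_unit_integrals[OF _ gaussian_cos_integral[OF a]] by blast
  then show ?thesis
    by (simp add: infsum_cmult_left' power_mult_distrib)
qed

lemma integral_cos_int: "integral {0..1} (\<lambda>x. cos (2 * pi * real_of_int k * x)) = (if k = 0 then 1 else 0)"
proof (cases "k = 0")
  case False
  have "((\<lambda>x. cos (2 * pi * real_of_int k * x)) has_integral
      sin (2 * pi * k * 1) / (2 * pi * k) - sin (2 * pi * k * 0) / (2 * pi * k)) {0..1}"
    using False
    by (intro fundamental_theorem_of_calculus)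
       (auto intro!: derivative_eq_intros simp: has_real_derivative_iff_has_vector_derivative[symmetric])
  moreover have "sin (2 * pi * real_of_int k) = 0" by (rule sin_int_2pin)
  ultimately show ?thesis using False by (simp add: integral_unique)
qed simp

lemma integral_cos_cos_int:
  fixes k m :: int
  shows "integral {0..1} (\<lambda>x. cos (2 * pi * k * x) * cos (2 * pi * m * x))
    = ((if k = m then 1 else 0) + (if k = - m then 1 else 0)) / 2"
proof -
  have "(\<lambda>x. cos (2 * pi * k * x) * cos (2 * pi * m * x))
     = (\<lambda>x. (1 / 2) * (cos (2 * pi * real_of_int (k - m) * x) + cos (2 * pi * real_of_int (k + m) * x)))"
    by (simp add: algebra_simps cos_add cos_diff)
  moreover have "(\<lambda>x. cos (2 * pi * real_of_int i * x)) integrable_on {0..1}" for i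
    by (intro integrable_continuous_interval continuous_intros)
  ultimately show ?thesis
    by (simp only: integral_mult_right integral_add integral_cos_int) (auto simp: algebra_simps)
qed

lemma summable_on_exp_minus_square:
  fixes b :: real
  assumes "b > 0"
  shows "(\<lambda>m::int. exp (- b * (real_of_int m)\<^sup>2)) summable_on UNIV"
  using summable_on_gaussian[of b 0] assms by simp

text \<open>The frequencies \<open>m\<close> and \<open>- m\<close> give the same cosine with the
  same weight, so each supplies half of the coefficient; for \<open>m = 0\<close> they coincide and
  one term supplies all of it.\<close>

lemma cos_series_coefficient:
  fixes b :: real and m :: int
  assumes b: "b > 0"
  shows "integral {0..1} (\<lambda>x. (\<Sum>\<^sub>\<infinity>k::int. exp (- b * (real_of_int k)\<^sup>2) * cos (2 * pi * k * x)) * cos (2 * pi * m * x))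
    = exp (- b * (real_of_int m)\<^sup>2)"
proof -
  let ?g = "\<lambda>(k::int) x. exp (- b * (real_of_int k)\<^sup>2) * cos (2 * pi * k * x) * cos (2 * pi * m * x)"
  have le: "\<bar>?g k x\<bar> \<le> exp (- b * (real_of_int k)\<^sup>2)" for k x
    by (simp add: abs_mult mult_left_le mult_le_one mult.assoc)
  have 1: "((\<lambda>k. integral {0..1} (?g k)) has_sum integral {0..1} (\<lambda>x. \<Sum>\<^sub>\<infinity>k. ?g k x)) UNIV"
    by (rule has_sum_integral_infsum[OF _ le summable_on_exp_minus_square[OF b]])
       (auto intro!: continuous_intros)
  have "integral {0..1} (?g k)
      = exp (- b * (real_of_int k)\<^sup>2) * (((if k = m then 1 else 0) + (if k = - m then 1 else 0)) / 2)" for k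
    by (subst integral_cos_cos_int[symmetric], subst integral_mult_right[symmetric]) (simp add: mult.assoc)
  then have "((\<lambda>k. exp (- b * (real_of_int k)\<^sup>2) * (((if k = m then 1 else 0) + (if k = - m then 1 else 0)) / 2))
      has_sum integral {0..1} (\<lambda>x. \<Sum>\<^sub>\<infinity>k. ?g k x)) UNIV"
    using 1 by (simp only:)
  moreover have "((\<lambda>k::int. exp (- b * (real_of_int k)\<^sup>2) * (((if k = m then 1 else 0) + (if k = - m then 1 else 0)) / 2))
      has_sum exp (- b * (real_of_int m)\<^sup>2)) UNIV"
    by (rule has_sum_finite_neutralI[of "{m, - m}"]) (auto, cases "m = 0", auto)
  ultimately show ?thesis
    using has_sum_unique by (fastforce simp: infsum_cmult_left')
qed

text \<open>Both sides are continuous, have period 1 and are invariant under replacing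
  \<open>x\<close> by \<open>1 - x\<close>. Their cosine coefficients agree, so they coincide on the
  unit interval, and \<open>frac x\<close> carries the identity to all \<open>x\<close>.\<close>

theorem poisson_gaussian:
  fixes a x :: real
  assumes a: "a > 0"
  shows "(\<Sum>\<^sub>\<infinity>j::int. exp (- a * (x - j)\<^sup>2))
    = sqrt (pi / a) * (\<Sum>\<^sub>\<infinity>m::int. exp (- (pi * m)\<^sup>2 / a) * cos (2 * pi * m * x))"
proof -
  define F where "F x = (\<Sum>\<^sub>\<infinity>j::int. exp (- a * (x - j)\<^sup>2))" for x
  define b where "b = pi\<^sup>2 / a"
  define S where "S x = (\<Sum>\<^sub>\<infinity>m::int. exp (- b * (real_of_int m)\<^sup>2) * cos (2 * pi * m * x))" for x
  have b: "b > 0" using a by (simp add: b_def)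
  have Fper: "F (x + of_int k) = F x" for x k
    unfolding F_def
    by (rule infsum_reindex_bij_witness[of _ "\<lambda>j. j + k" "\<lambda>j. j - k"]) (auto simp: algebra_simps)
  have Fsym: "F (1 - x) = F x" for x
    unfolding F_def
    by (rule infsum_reindex_bij_witness[of _ "\<lambda>j. 1 - j" "\<lambda>j. 1 - j"])
       (auto simp: power2_commute algebra_simps)
  have Sper: "S (x + of_int k) = S x" for x k
    unfolding S_def by (simp add: cos_int_mult_shift)
  have Ssym: "S (1 - x) = S x" for x
  proof -
    have "cos (2 * pi * m * (1 - x)) = cos (2 * pi * m * x)" for m :: int
      using cos_int_mult_shift[of m "- x" 1] by (simp add: algebra_simps)
    then show ?thesis by (simp add: S_def)
  qed
  have contF: "continuous_on {0..1} F"
    unfolding F_def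
  proof (rule continuous_on_infsum[OF _ _ summable_on_cmult_right[OF summable_on_exp_minus_abs]])
    show "\<bar>exp (- a * (x - real_of_int j)\<^sup>2)\<bar> \<le> exp (1 + 1 / (4 * a)) * exp (- \<bar>real_of_int j\<bar>)"
      if "x \<in> {0..1}" for j x
      using exp_gaussian_le[OF a, of x 1 j] that by simp
  qed (intro continuous_intros)
  have contS: "continuous_on {0..1} S"
    unfolding S_def
    by (rule continuous_on_infsum[OF _ _ summable_on_exp_minus_square[OF b]])
       (auto intro!: continuous_intros simp: abs_mult mult_left_le)
  let ?h = "\<lambda>x. F x - sqrt (pi / a) * S x"
  have "?h y = 0" if "y \<in> {0..1}" for y
  proof (rule cosine_coefficients_unique[OF _ _ _ that])
    show "continuous_on {0..1} ?h" by (intro continuous_intros contF contS)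
    show "?h (1 - x) = ?h x" for x by (simp add: Fsym Ssym)
    fix m :: int
    have "integral {0..1} (\<lambda>x. ?h x * cos (2 * pi * m * x))
      = integral {0..1} (\<lambda>x. F x * cos (2 * pi * m * x) - sqrt (pi / a) * (S x * cos (2 * pi * m * x)))"
      by (simp add: algebra_simps)
    also have "\<dots> = integral {0..1} (\<lambda>x. F x * cos (2 * pi * m * x))
        - sqrt (pi / a) * integral {0..1} (\<lambda>x. S x * cos (2 * pi * m * x))"
      by (subst integral_diff)
        (auto intro!: integrable_continuous_interval continuous_intros contF contS)
    also have "\<dots> = 0"
      unfolding F_def gaussian_sum_cos_coefficient[OF a] S_def cos_series_coefficient[OF b]
      by (simp add: b_def power_mult_distrib)
    finally show "integral {0..1} (\<lambda>x. ?h x * cos (2 * pi * m * x)) = 0" .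
  qed
  from this[of "frac x"] have "F (frac x) = sqrt (pi / a) * S (frac x)"
    by (simp add: frac_ge_0 less_imp_le[OF frac_lt_1])
  moreover have "frac x = x + of_int (- \<lfloor>x\<rfloor>)" by (simp add: frac_def)
  ultimately have "F x = sqrt (pi / a) * S x" by (simp only: Fper Sper)
  then show ?thesis by (simp add: F_def S_def b_def power_mult_distrib)
qed

lemma infsum_int_parity_split:
  fixes f :: "int \<Rightarrow> real"
  assumes "f summable_on UNIV"
  shows "infsum f UNIV = (\<Sum>\<^sub>\<infinity>k. f (2 * k)) + (\<Sum>\<^sub>\<infinity>k. f (2 * k + 1))"
proof -
  have U: "(UNIV :: int set) = range (\<lambda>k. 2 * k) \<union> range (\<lambda>k. 2 * k + 1)"
    by (auto elim: oddE) (metis evenE oddE rangeI)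
  have "infsum f (range (\<lambda>k. 2 * k) \<union> range (\<lambda>k. 2 * k + 1))
      = infsum f (range (\<lambda>k. 2 * k)) + infsum f (range (\<lambda>k. 2 * k + 1))"
    by (rule infsum_Un_disjoint) (use assms summable_on_subset in \<open>auto dest: arg_cong[of _ _ even]\<close>)
  then show ?thesis
    unfolding U[symmetric] by (simp add: infsum_reindex inj_on_def o_def)
qed

text \<open>The alternating sum is twice the sum over even \<open>j\<close> minus the full sum. The
  even terms form a Gaussian sum for \<open>4 * a\<close> at \<open>x / 2\<close>, whose dual series
  \<open>c\<close> has the frequencies \<open>m / 2\<close>; subtracting the full sum removes the
  integral ones.\<close>

theorem poisson_gaussian_alternating:
  fixes a x :: real
  assumes a: "a > 0"
  shows "(\<Sum>\<^sub>\<infinity>j::int. (if even j then 1 else - 1) * exp (- a * (x - j)\<^sup>2))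
    = sqrt (pi / a) * (\<Sum>\<^sub>\<infinity>m::int. exp (- (pi * (m + 1 / 2))\<^sup>2 / a) * cos (2 * pi * (m + 1 / 2) * x))"
proof -
  define g where "g j = exp (- a * (x - real_of_int j)\<^sup>2)" for j
  define h where "h j = (if even j then 1 else - 1) * g j" for j
  define c where "c m = exp (- (pi * real_of_int m)\<^sup>2 / (4 * a)) * cos (pi * m * x)" for m
  have sg: "g summable_on UNIV"
    unfolding g_def by (rule summable_on_gaussian[OF a])
  have sh: "h summable_on UNIV"
  proof -
    have "(\<lambda>j. norm (h j)) summable_on UNIV"
      using sg by (rule summable_on_cong[THEN iffD1, rotated]) (auto simp: h_def g_def)
    then show ?thesis by (rule abs_summable_summable)
  qed
  have sc: "c summable_on UNIV"
  proof -
    have "(\<lambda>m::int. exp (- (pi\<^sup>2 / (4 * a)) * (real_of_int m)\<^sup>2)) summable_on UNIV"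
      using a by (intro summable_on_exp_minus_square) simp
    then have "(\<lambda>m. norm (c m)) summable_on UNIV"
      by (rule summable_on_comparison_test)
         (auto simp: c_def abs_mult mult_left_le power_mult_distrib)
    then show ?thesis by (rule abs_summable_summable)
  qed
  have "g (2 * k) = exp (- (4 * a) * (x / 2 - k)\<^sup>2)" for k
    by (simp add: g_def power2_eq_square algebra_simps)
  then have ev: "2 * (\<Sum>\<^sub>\<infinity>k. g (2 * k)) = sqrt (pi / a) * infsum c UNIV"
    using poisson_gaussian[of "4 * a" "x / 2"] a
    by (simp add: c_def[abs_def] real_sqrt_mult real_sqrt_divide mult.assoc)
  have all: "infsum g UNIV = sqrt (pi / a) * (\<Sum>\<^sub>\<infinity>m. c (2 * m))"
    unfolding g_def poisson_gaussian[OF a]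
    by (simp add: c_def power_mult_distrib mult.assoc mult.left_commute)
  have "infsum h UNIV = (\<Sum>\<^sub>\<infinity>k. g (2 * k)) + (\<Sum>\<^sub>\<infinity>k. - g (2 * k + 1))"
    unfolding infsum_int_parity_split[OF sh] by (simp add: h_def)
  also have "\<dots> = 2 * (\<Sum>\<^sub>\<infinity>k. g (2 * k)) - infsum g UNIV"
    unfolding infsum_int_parity_split[OF sg] by (simp add: infsum_uminus)
  also have "\<dots> = sqrt (pi / a) * (\<Sum>\<^sub>\<infinity>m. c (2 * m + 1))"
    unfolding ev all infsum_int_parity_split[OF sc] by (simp add: algebra_simps)
  finally have "infsum h UNIV = sqrt (pi / a) * (\<Sum>\<^sub>\<infinity>m. c (2 * m + 1))" .
  moreover have "c (2 * m + 1) = exp (- (pi * (m + 1 / 2))\<^sup>2 / a) * cos (2 * pi * (m + 1 / 2) * x)" for m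
  proof -
    have "(pi * (2 * real_of_int m + 1))\<^sup>2 / (4 * a) = (pi * (m + 1 / 2))\<^sup>2 / a"
      by (simp add: power_mult_distrib power2_eq_square field_simps)
    then show ?thesis by (simp add: c_def algebra_simps)
  qed
  ultimately show ?thesis by (simp only: h_def[abs_def] g_def)
qed

section \<open>Truncation of the dual series\<close>

text \<open>Off \<open>A\<close>, \<open>exp (- c * M m)\<close> is at most
  \<open>exp (- M m)\<close> times \<open>exp (- (c - 1) * K)\<close>: the excess
  \<open>c - 1\<close> is charged to the gap \<open>K\<close>, and one copy of \<open>M\<close>
  keeps the series summable. The constant is therefore independent of \<open>c\<close> and
  \<open>w\<close>.\<close>

lemma exp_series_truncation:
  fixes M w :: "'a \<Rightarrow> real"
  assumes A: "finite A" and K: "\<And>m. m \<notin> A \<Longrightarrow> K \<le> M m"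
    and S: "(\<lambda>m. exp (- M m)) summable_on UNIV"
    and c: "c \<ge> 1" and w: "\<And>m. \<bar>w m\<bar> \<le> 1"
  shows "\<bar>(\<Sum>\<^sub>\<infinity>m. exp (- c * M m) * w m) - (\<Sum>m\<in>A. exp (- c * M m) * w m)\<bar>
    \<le> exp K * (\<Sum>\<^sub>\<infinity>m. exp (- M m)) * exp (- c * K)"
proof -
  let ?f = "\<lambda>m. exp (- c * M m) * w m" and ?B = "exp K * exp (- c * K)"
  have le: "norm (?f m) \<le> ?B * exp (- M m)" if "m \<in> - A" for m
  proof -
    have "0 \<le> (c - 1) * (M m - K)" using K[of m] c that by auto
    then have "exp (- c * M m) \<le> ?B * exp (- M m)"
      by (simp add: algebra_simps flip: exp_add)
    then show ?thesis using w[of m] by (simp add: abs_mult) (smt (verit) exp_ge_zero mult_left_le)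
  qed
  have S': "(\<lambda>m. ?B * exp (- M m)) summable_on X" for X
    using summable_on_subset[OF S, of X] by (intro summable_on_cmult_right) auto
  have "(\<lambda>m. norm (?f m)) summable_on - A"
    by (rule summable_on_comparison_test[OF S']) (use le in auto)
  then have sA: "?f summable_on - A" by (rule abs_summable_summable)
  have "infsum ?f UNIV = infsum ?f A + infsum ?f (- A)"
    using infsum_Un_disjoint[of ?f A "- A"] A sA by simp
  then have "\<bar>infsum ?f UNIV - sum ?f A\<bar> = norm (infsum ?f (- A))"
    using A by simp
  also have "\<dots> \<le> (\<Sum>\<^sub>\<infinity>m\<in>- A. ?B * exp (- M m))"
    by (rule norm_infsum_le[OF has_sum_infsum[OF sA] has_sum_infsum[OF S'] le])
  also have "\<dots> \<le> (\<Sum>\<^sub>\<infinity>m. ?B * exp (- M m))"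
    by (rule infsum_mono2[OF S' S']) auto
  also have "\<dots> = exp K * (\<Sum>\<^sub>\<infinity>m. exp (- M m)) * exp (- c * K)"
    unfolding infsum_cmult_right' by simp
  finally show ?thesis .
qed

text \<open>\<open>m\<^sup>2 + m = (m + 1/2)\<^sup>2 - 1/4\<close> is the exponent of the half-odd
  frequency \<open>m + 1/2\<close> once that of the lowest one is factored out.\<close>

lemma summable_on_exp_minus_square_plus:
  fixes b :: real
  assumes "b > 0"
  shows "(\<lambda>m::int. exp (- (b * real_of_int (m\<^sup>2 + m)))) summable_on UNIV"
proof -
  have "exp (- (b * real_of_int (m\<^sup>2 + m))) = exp (b / 4) * exp (- b * (- 1 / 2 - m)\<^sup>2)" for m :: int
    by (simp add: power2_eq_square algebra_simps flip: exp_add)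
  then show ?thesis
    using summable_on_cmult_right[OF summable_on_gaussian[OF assms]] by simp
qed

lemma int_square_plus_ge:
  fixes m k :: int
  assumes "0 \<le> k" "m \<notin> {- k..<k}"
  shows "k\<^sup>2 + k \<le> m\<^sup>2 + m"
proof -
  have "0 \<le> (m - k) * (m + k + 1)"
    using assms by (auto simp: zero_le_mult_iff)
  then show ?thesis by (simp add: algebra_simps power2_eq_square)
qed

lemma abs_mult_diff_le:
  fixes p u v e :: real
  assumes "p \<ge> 0" "\<bar>u - v\<bar> \<le> e"
  shows "\<bar>p * u - p * v\<bar> \<le> p * e"
  unfolding right_diff_distrib[symmetric] abs_mult using assms by (simp add: mult_left_mono)

lemma gaussian_sum_asymptotic:
  "\<exists>C\<ge>0. \<forall>l\<ge>1. \<forall>x::real.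
    \<bar>(\<Sum>\<^sub>\<infinity>j::int. exp (- (pi / l) * (x - j)\<^sup>2)) - sqrt l\<bar> \<le> C * sqrt l * exp (- pi * l)"
proof (intro exI conjI allI impI)
  let ?C = "exp pi * (\<Sum>\<^sub>\<infinity>m::int. exp (- (pi * (real_of_int m)\<^sup>2)))"
  show "?C \<ge> 0" by (intro mult_nonneg_nonneg infsum_nonneg) auto
  fix l x :: real assume l: "l \<ge> 1"
  let ?S = "\<Sum>\<^sub>\<infinity>m::int. exp (- l * (pi * (real_of_int m)\<^sup>2)) * cos (2 * pi * m * x)"
  have "1 \<le> (real_of_int m)\<^sup>2" if "m \<noteq> 0" for m
    using that by (metis of_int_1_le_iff of_int_power int_one_le_iff_zero_less zero_less_power2)
  then have "\<bar>?S - (\<Sum>m\<in>{0::int}. exp (- l * (pi * (real_of_int m)\<^sup>2)) * cos (2 * pi * m * x))\<bar>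
      \<le> ?C * exp (- l * pi)"
    by (intro exp_series_truncation l) (use summable_on_exp_minus_square[of pi] in auto)
  then have "\<bar>?S - 1\<bar> \<le> ?C * exp (- pi * l)" by (simp add: mult.commute)
  then have "\<bar>sqrt l * ?S - sqrt l * 1\<bar> \<le> sqrt l * (?C * exp (- pi * l))"
    using l by (intro abs_mult_diff_le) auto
  moreover have "(\<Sum>\<^sub>\<infinity>j::int. exp (- (pi / l) * (x - j)\<^sup>2)) = sqrt l * ?S"
    using poisson_gaussian[of "pi / l" x] l by (simp add: power_mult_distrib power2_eq_square mult_ac)
  ultimately show "\<bar>(\<Sum>\<^sub>\<infinity>j::int. exp (- (pi / l) * (x - j)\<^sup>2)) - sqrt l\<bar> \<le> ?C * sqrt l * exp (- pi * l)"
    by (simp only: mult_1_right mult_ac)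
qed

text \<open>\<open>k\<close> counts the pairs \<open>m\<close>, \<open>- 1 - m\<close> that are
  kept, and the next pair fixes the rate \<open>k\<^sup>2 + k\<close>. The scale is written
  \<open>r * l\<close> so that \<open>l \<ge> 1\<close> remains the large parameter for
  \<open>r = 2 / 3\<close>, the value needed for Euler's product.\<close>

lemma alternating_gaussian_sum_truncation:
  fixes r :: real and k :: int
  assumes r: "r > 0" and k: "k \<ge> 0"
  obtains C where "C \<ge> 0" "\<And>l x :: real. l \<ge> 1 \<Longrightarrow>
    \<bar>(\<Sum>\<^sub>\<infinity>j::int. (if even j then 1 else - 1) * exp (- (pi / (r * l)) * (x - j)\<^sup>2))
      - sqrt (r * l) * exp (- pi * (r * l) / 4)
          * (\<Sum>m\<in>{- k..<k}. exp (- l * (pi * r * real_of_int (m\<^sup>2 + m))) * cos (2 * pi * (m + 1 / 2) * x))\<bar>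
      \<le> C * sqrt (r * l) * exp (- pi * (r * l) / 4) * exp (- l * (pi * r * real_of_int (k\<^sup>2 + k)))"
proof
  let ?K = "pi * r * real_of_int (k\<^sup>2 + k)"
  let ?C = "exp ?K * (\<Sum>\<^sub>\<infinity>m::int. exp (- (pi * r * real_of_int (m\<^sup>2 + m))))"
  show "?C \<ge> 0" by (intro mult_nonneg_nonneg infsum_nonneg) auto
  fix l x :: real assume l: "l \<ge> 1"
  let ?f = "\<lambda>m::int. exp (- l * (pi * r * real_of_int (m\<^sup>2 + m))) * cos (2 * pi * (m + 1 / 2) * x)"
  let ?p = "sqrt (r * l) * exp (- pi * (r * l) / 4)"
  have p: "?p > 0" using r l by auto
  have "\<bar>infsum ?f UNIV - sum ?f {- k..<k}\<bar> \<le> ?C * exp (- l * ?K)"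
  proof (rule exp_series_truncation[OF _ _ _ l])
    show "?K \<le> pi * r * real_of_int (m\<^sup>2 + m)" if "m \<notin> {- k..<k}" for m
    proof -
      have "real_of_int (k\<^sup>2 + k) \<le> real_of_int (m\<^sup>2 + m)"
        using int_square_plus_ge[OF k that] by (simp only: of_int_le_iff)
      then show ?thesis using r by (intro mult_left_mono) auto
    qed
    show "(\<lambda>m::int. exp (- (pi * r * real_of_int (m\<^sup>2 + m)))) summable_on UNIV"
      using r by (intro summable_on_exp_minus_square_plus) auto
  qed auto
  then have 1: "\<bar>?p * infsum ?f UNIV - ?p * sum ?f {- k..<k}\<bar> \<le> ?p * (?C * exp (- l * ?K))"
    using p by (intro abs_mult_diff_le) auto
  have "exp (- (pi * (real_of_int m + 1 / 2))\<^sup>2 / (pi / (r * l)))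
      = exp (- pi * (r * l) / 4) * exp (- l * (pi * r * real_of_int (m\<^sup>2 + m)))" for m
  proof -
    have "(pi * (real_of_int m + 1 / 2))\<^sup>2 / (pi / (r * l)) = pi * (r * l) * (real_of_int m + 1 / 2)\<^sup>2"
      by (simp add: power2_eq_square)
    also have "\<dots> = pi * (r * l) / 4 + l * (pi * r * real_of_int (m\<^sup>2 + m))"
      by (simp add: power2_eq_square algebra_simps)
    finally show ?thesis by (simp flip: exp_add)
  qed
  then have "(\<Sum>\<^sub>\<infinity>m::int. exp (- (pi * (m + 1 / 2))\<^sup>2 / (pi / (r * l))) * cos (2 * pi * (m + 1 / 2) * x))
      = exp (- pi * (r * l) / 4) * infsum ?f UNIV"
    by (simp only: mult.assoc infsum_cmult_right')
  then have 2: "(\<Sum>\<^sub>\<infinity>j::int. (if even j then 1 else - 1) * exp (- (pi / (r * l)) * (x - j)\<^sup>2)) = ?p * infsum ?f UNIV"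
    using poisson_gaussian_alternating[of "pi / (r * l)" x] r l by simp
  show "\<bar>(\<Sum>\<^sub>\<infinity>j::int. (if even j then 1 else - 1) * exp (- (pi / (r * l)) * (x - j)\<^sup>2))
      - ?p * sum ?f {- k..<k}\<bar> \<le> ?C * sqrt (r * l) * exp (- pi * (r * l) / 4) * exp (- l * ?K)"
    using 1 unfolding 2 by (simp only: mult_ac)
qed

lemma alternating_gaussian_sum_asymptotic:
  "\<exists>C\<ge>0. \<forall>l\<ge>1. \<forall>x::real.
    \<bar>(\<Sum>\<^sub>\<infinity>j::int. (if even j then 1 else - 1) * exp (- (pi / l) * (x - j)\<^sup>2))
      - 2 * sqrt l * exp (- pi * l / 4) * cos (pi * x)\<bar>
    \<le> C * sqrt l * exp (- pi * l / 4) * exp (- 2 * pi * l)"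
proof -
  obtain C where C: "C \<ge> 0" "\<And>l x :: real. l \<ge> 1 \<Longrightarrow>
    \<bar>(\<Sum>\<^sub>\<infinity>j::int. (if even j then 1 else - 1) * exp (- (pi / (1 * l)) * (x - j)\<^sup>2))
      - sqrt (1 * l) * exp (- pi * (1 * l) / 4)
          * (\<Sum>m\<in>{- 1..<1}. exp (- l * (pi * 1 * real_of_int (m\<^sup>2 + m))) * cos (2 * pi * (m + 1 / 2) * x))\<bar>
      \<le> C * sqrt (1 * l) * exp (- pi * (1 * l) / 4) * exp (- l * (pi * 1 * real_of_int (1\<^sup>2 + 1)))"
    by (rule alternating_gaussian_sum_truncation[of 1 1]) auto
  \<comment> \<open>Both kept indices have \<open>m\<^sup>2 + m = 0\<close> and contribute
    \<open>cos (pi * x)\<close>, hence the factor 2; the first dropped pair gives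
    \<open>exp (- 2 * pi * l)\<close>.\<close>
  have "{- 1..<1 :: int} = {- 1, 0}" by auto
  with C show ?thesis by (intro exI[of _ C]) (simp add: mult_ac)
qed

subsection \<open>Euler's product\<close>

text \<open>Shanks' finite form of Euler's pentagonal number theorem: for \<open>n \<rightarrow> \<infinity>\<close> only the term \<open>s = 0\<close> of the
  left-hand side survives.\<close>

lemma shanks_identity:
  fixes q :: real
  shows "(\<Sum>s\<le>n. (-1) ^ s * (\<Prod>k=s..<n. 1 - q ^ Suc k) * q ^ (s * n + triangle s))
    = 1 + (\<Sum>s<n. (-1) ^ Suc s * (q ^ ((Suc s)\<^sup>2 + triangle s) + q ^ ((Suc s)\<^sup>2 + triangle (Suc s))))"
proof (induction n)
  case (Suc n)
  let ?R = "\<lambda>s n. \<Prod>k=s..<n. 1 - q ^ Suc k"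
  let ?N = "Suc n"
  define G where "G s = (-1) ^ s * ?R s n * q ^ (s * ?N + triangle s + ?N)" for s
  \<comment> \<open>The new factor yields \<open>q ^ s - q ^ (s + ?N)\<close>, and
    \<open>q ^ s\<close> is written as \<open>1 - (1 - q ^ s)\<close>. The factor
    \<open>1 - q ^ s\<close> extends the product downwards by one index, so the middle term at
    \<open>s + 1\<close> is \<open>- G s\<close> and the last two sums cancel up to
    \<open>G n\<close>.\<close>
  have eq: "(-1) ^ s * ?R s ?N * q ^ (s * ?N + triangle s)
      = (-1) ^ s * ?R s n * q ^ (s * n + triangle s)
        - (-1) ^ s * ?R s n * (1 - q ^ s) * q ^ (s * n + triangle s) - G s" if "s \<le> n" for s
    using that by (simp add: G_def algebra_simps power_add)
  have shift: "(-1) ^ Suc s * ?R (Suc s) n * (1 - q ^ Suc s) * q ^ (Suc s * n + triangle (Suc s)) = - G s"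
    if "s < n" for s
  proof -
    have "?R s n = (1 - q ^ Suc s) * ?R (Suc s) n"
      using that by (rule prod.atLeast_Suc_lessThan)
    moreover have "Suc s * n + triangle (Suc s) = s * ?N + triangle s + ?N"
      by simp
    moreover have "(-1 :: real) ^ Suc s = - ((-1) ^ s)" by simp
    ultimately show ?thesis
      unfolding G_def by (simp only: mult_minus_left mult_minus_right mult_ac)
  qed
  have "(\<Sum>s\<le>n. (-1) ^ s * ?R s n * (1 - q ^ s) * q ^ (s * n + triangle s)) = - (\<Sum>s<n. G s)"
    unfolding sum.atMost_shift sum_negf[symmetric] by (simp add: shift del: prod.op_ivl_Suc power_Suc triangle_Suc mult_Suc)
  moreover have "(\<Sum>s\<le>n. G s) = (\<Sum>s<n. G s) + G n"
    by (simp flip: lessThan_Suc_atMost)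
  moreover have "(\<Sum>s\<le>n. (-1) ^ s * ?R s ?N * q ^ (s * ?N + triangle s))
      = (\<Sum>s\<le>n. (-1) ^ s * ?R s n * q ^ (s * n + triangle s))
        - (\<Sum>s\<le>n. (-1) ^ s * ?R s n * (1 - q ^ s) * q ^ (s * n + triangle s)) - (\<Sum>s\<le>n. G s)"
    unfolding sum_subtractf[symmetric] by (rule sum.cong) (simp_all only: eq atMost_iff)
  ultimately have 1: "(\<Sum>s\<le>n. (-1) ^ s * ?R s ?N * q ^ (s * ?N + triangle s))
      = (\<Sum>s\<le>n. (-1) ^ s * ?R s n * q ^ (s * n + triangle s)) - G n"
    by simp
  have 2: "- G n = (-1) ^ ?N * q ^ (?N\<^sup>2 + triangle n)"
    by (simp add: G_def power2_eq_square algebra_simps)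
  have 3: "(-1) ^ ?N * ?R ?N ?N * q ^ (?N * ?N + triangle ?N) = (-1) ^ ?N * q ^ (?N\<^sup>2 + triangle ?N)"
    by (simp add: power2_eq_square)
  show ?case
    using Suc.IH 2 unfolding sum.atMost_Suc sum.lessThan_Suc distrib_left 1 3 by linarith
qed simp

section \<open>The q-Pochhammer product and its pentagonal series\<close>

lemma convergent_prod_qpoch:
  fixes x q :: real
  assumes "0 \<le> q" "q < 1"
  shows "convergent_prod (\<lambda>k. 1 - x * q ^ k)"
  using assms
  by (intro abs_convergent_prod_imp_convergent_prod summable_imp_abs_convergent_prod)
     (auto simp: abs_mult intro!: summable_mult summable_geometric)

lemma qpoch_inf_LIMSEQ:
  fixes x q :: real
  assumes "0 \<le> q" "q < 1"
  shows "(\<lambda>n. \<Prod>k<n. 1 - x * q ^ k) \<longlonglongrightarrow> qpoch_inf x q"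
  using convergent_prod_LIMSEQ[OF convergent_prod_qpoch[OF assms, of x]]
  unfolding qpoch_inf_def LIMSEQ_lessThan_iff_atMost .

text \<open>The lower bound is the Weierstrass product inequality combined with the geometric
  series; it measures the cost of replacing \<open>qpoch_inf x q\<close> by 1.\<close>

lemma qpoch_inf_bounds:
  fixes x q :: real
  assumes q: "0 \<le> q" "q < 1" and x: "0 \<le> x" "x \<le> 1"
  shows "0 \<le> qpoch_inf x q" "qpoch_inf x q \<le> 1" "1 - x / (1 - q) \<le> qpoch_inf x q"
proof -
  have le: "0 \<le> x * q ^ k" "x * q ^ k \<le> 1" for k
    using q x by (auto intro!: mult_le_one power_le_one)
  show "0 \<le> qpoch_inf x q"
    by (rule LIMSEQ_le_const[OF qpoch_inf_LIMSEQ[OF q]]) (use le in \<open>auto intro!: prod_nonneg\<close>)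
  show "qpoch_inf x q \<le> 1"
    by (rule LIMSEQ_le_const2[OF qpoch_inf_LIMSEQ[OF q]]) (use le in \<open>auto intro!: prod_le_1\<close>)
  have "1 - x / (1 - q) \<le> (\<Prod>k<n. 1 - x * q ^ k)" for n
  proof -
    have "(\<Sum>k<n. q ^ k) \<le> 1 / (1 - q)"
      using q by (simp add: sum_gp_strict divide_right_mono)
    then have "x * (\<Sum>k<n. q ^ k) \<le> x * (1 / (1 - q))"
      using x by (intro mult_left_mono)
    then have "1 - x / (1 - q) \<le> 1 - (\<Sum>k<n. x * q ^ k)"
      by (simp add: sum_distrib_left)
    also have "\<dots> \<le> (\<Prod>k<n. 1 - x * q ^ k)"
      by (rule Weierstrass_prod_ineq) (use le in auto)
    finally show ?thesis .
  qed
  then show "1 - x / (1 - q) \<le> qpoch_inf x q"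
    by (intro LIMSEQ_le_const[OF qpoch_inf_LIMSEQ[OF q]]) auto
qed

theorem pentagonal_number:
  fixes t :: real
  assumes t: "t > 0"
  shows "qpoch_inf (exp (- t)) (exp (- t))
    = (\<Sum>\<^sub>\<infinity>j::int. (if even j then 1 else - 1) * exp (- t * (of_int j * (3 * of_int j + 1) / 2)))"
proof -
  define q where "q = exp (- t)"
  have q: "0 < q" "q < 1" using t by (auto simp: q_def)
  define u where "u j = (if even j then 1 else - 1) * exp (- t * (of_int j * (3 * of_int j + 1) / 2))" for j :: int
  define F where "F n = (\<Sum>s\<le>n. (-1) ^ s * (\<Prod>k=s..<n. 1 - q ^ Suc k) * q ^ (s * n + triangle s))" for n
  have qpow: "q ^ n = exp (- t * real n)" for n
    by (simp add: q_def exp_of_nat_mult[symmetric] mult.commute)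
  have tri: "real (triangle n) = real n * (real n + 1) / 2" for n
    by (induction n) (simp_all add: field_simps)
  \<comment> \<open>The exponents in Shanks' sum are \<open>j * (3 * j + 1) / 2\<close> at
    \<open>j = - (s + 1)\<close> and \<open>j = s + 1\<close>, so it runs over all \<open>j\<close>
    from \<open>- n\<close> to \<open>n\<close>; the extra term is the one at \<open>j = n\<close>,
    which the half-open range omits.\<close>
  have F: "F n = (\<Sum>j\<in>{- int n..<int n}. u j) + (-1) ^ n * q ^ (n\<^sup>2 + triangle n)" for n
    unfolding F_def shanks_identity
  proof (induction n)
    case (Suc n)
    have "{- int (Suc n)..<int (Suc n)} = insert (- int (Suc n)) (insert (int n) {- int n..<int n})" by auto
    then have "(\<Sum>j\<in>{- int (Suc n)..<int (Suc n)}. u j)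
       = u (- int (Suc n)) + u (int n) + (\<Sum>j\<in>{- int n..<int n}. u j)"
      by simp
    moreover have "u (int n) = (-1) ^ n * q ^ (n\<^sup>2 + triangle n)"
      by (simp add: u_def qpow tri power2_eq_square minus_one_power_iff) (simp add: algebra_simps)
    moreover have "u (- int (Suc n)) = (-1) ^ Suc n * q ^ ((Suc n)\<^sup>2 + triangle n)"
      unfolding u_def qpow
      by (simp add: tri power2_eq_square minus_one_power_iff) (simp add: field_simps)
    ultimately show ?case
      using Suc.IH unfolding sum.lessThan_Suc by (simp only: distrib_left)
  qed simp
  have n0: "(\<lambda>n. real n * q ^ n) \<longlonglongrightarrow> 0" and q0: "(\<lambda>n. q ^ n) \<longlonglongrightarrow> 0"
    using powser_times_n_limit_0[of q] q by (auto intro: LIMSEQ_power_zero)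
  have P: "(\<lambda>n. \<Prod>k=0..<n. 1 - q ^ Suc k) \<longlonglongrightarrow> qpoch_inf q q"
    using qpoch_inf_LIMSEQ[of q q] q by (simp add: atLeast0LessThan)
  have "(\<lambda>n. F n - (\<Prod>k=0..<n. 1 - q ^ Suc k)) \<longlonglongrightarrow> 0"
  proof (rule Lim_null_comparison[OF _ n0], rule always_eventually, rule allI)
    fix n
    have le: "\<bar>(-1) ^ s * (\<Prod>k=s..<n. 1 - q ^ Suc k) * q ^ (s * n + triangle s)\<bar> \<le> q ^ n" if "s \<in> {1..n}" for s
    proof -
      have "0 \<le> (\<Prod>k=s..<n. 1 - q ^ Suc k)" "(\<Prod>k=s..<n. 1 - q ^ Suc k) \<le> 1"
        using q by (auto intro!: prod_nonneg prod_le_1 power_le_one mult_le_one)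
      then have "\<bar>(-1) ^ s * (\<Prod>k=s..<n. 1 - q ^ Suc k) * q ^ (s * n + triangle s)\<bar> \<le> q ^ (s * n + triangle s)"
        using q by (simp add: abs_mult mult_left_le_one_le)
      also have "\<dots> \<le> q ^ n"
        using q that by (intro power_decreasing) (auto simp: trans_le_add1)
      finally show ?thesis .
    qed
    have "{..n} = insert 0 {1..n}" by auto
    then have "F n - (\<Prod>k=0..<n. 1 - q ^ Suc k)
        = (\<Sum>s\<in>{1..n}. (-1) ^ s * (\<Prod>k=s..<n. 1 - q ^ Suc k) * q ^ (s * n + triangle s))"
      by (simp add: F_def)
    also have "norm \<dots> \<le> (\<Sum>s\<in>{1..n}. q ^ n)"
      by (rule sum_norm_le) (use le in simp)
    finally show "norm (F n - (\<Prod>k=0..<n. 1 - q ^ Suc k)) \<le> real n * q ^ n" by simp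
  qed
  from tendsto_add[OF this P] have "F \<longlonglongrightarrow> qpoch_inf q q" by simp
  moreover have "(\<lambda>n. (-1) ^ n * q ^ (n\<^sup>2 + triangle n)) \<longlonglongrightarrow> 0"
  proof (rule Lim_null_comparison[OF _ q0], rule always_eventually, rule allI)
    fix n show "norm ((-1) ^ n * q ^ (n\<^sup>2 + triangle n)) \<le> q ^ n"
      using q by (auto simp: abs_mult power2_eq_square intro!: power_decreasing trans_le_add1)
  qed
  ultimately have "(\<lambda>n. F n - (-1) ^ n * q ^ (n\<^sup>2 + triangle n)) \<longlonglongrightarrow> qpoch_inf q q - 0"
    by (rule tendsto_diff)
  then have "(\<lambda>n. \<Sum>j\<in>{- int n..<int n}. u j) \<longlonglongrightarrow> qpoch_inf q q" by (simp add: F)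
  moreover have "u summable_on UNIV"
  proof -
    \<comment> \<open>\<open>j * (3 * j + 1) / 2 = 3 / 2 * (j + 1 / 6)\<^sup>2 - 1 / 24\<close>; the
      offset \<open>1 / 24\<close> is the source of the exponent
      \<open>pi / (24 * l)\<close>.\<close>
    have "exp (- t * (of_int j * (3 * of_int j + 1) / 2)) = exp (t / 24) * exp (- (3 * t / 2) * (- 1 / 6 - j)\<^sup>2)"
      for j :: int
      by (simp add: power2_eq_square algebra_simps flip: exp_add) (simp add: field_simps)
    then have "norm (u j) = exp (t / 24) * exp (- (3 * t / 2) * (- 1 / 6 - j)\<^sup>2)" for j
      by (simp add: u_def)
    then have "(\<lambda>j. norm (u j)) summable_on UNIV"
      using t by (simp only:) (intro summable_on_cmult_right summable_on_gaussian, simp)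
    then show ?thesis by (rule abs_summable_summable)
  qed
  then have "(\<lambda>n. \<Sum>j\<in>{- int n..<int n}. u j) \<longlonglongrightarrow> infsum u UNIV"
    by (intro filterlim_compose[OF _ filterlim_int_interval_finite_subsets])
       (simp add: has_sum_def[symmetric])
  ultimately have "qpoch_inf q q = infsum u UNIV" by (rule LIMSEQ_unique)
  then show ?thesis by (simp only: q_def u_def[abs_def])
qed

text \<open>Completing the square in the pentagonal series gives an alternating Gaussian sum at
  \<open>x = -1/6\<close>. Its dual frequencies \<open>\<plusminus>3/2\<close> drop out because \<open>cos (\<pi>/2) = 0\<close>, so the error comes only from
  the frequencies \<open>\<plusminus>5/2\<close>; with those at \<open>\<plusminus>3/2\<close> it would be \<open>exp (-4\<pi>l/3)\<close>, too large for the second expansion.\<close>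

lemma qpoch_inf_asymptotic:
  "\<exists>C\<ge>0. \<forall>l\<ge>1.
    \<bar>qpoch_inf (exp (- pi / l)) (exp (- pi / l)) - sqrt (2 * l) * exp (pi / (24 * l) - pi * l / 6)\<bar>
    \<le> C * (sqrt (2 * l) * exp (pi / (24 * l) - pi * l / 6)) * exp (- 4 * pi * l)"
proof -
  let ?f = "\<lambda>(l::real) (x::real) (m::int). exp (- l * (pi * (2 / 3) * real_of_int (m\<^sup>2 + m))) * cos (2 * pi * (m + 1 / 2) * x)"
  let ?A = "\<lambda>(r::real) (x::real). \<Sum>\<^sub>\<infinity>j::int. (if even j then 1 else - 1) * exp (- (pi / r) * (x - j)\<^sup>2)"
  \<comment> \<open>\<open>r = 2 / 3\<close> because
    \<open>3 / 2 * (pi / l) = pi / (2 / 3 * l)\<close>; keeping two pairs leaves the rate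
    \<open>2 / 3 * (2\<^sup>2 + 2) = 4\<close>.\<close>
  obtain C where C: "C \<ge> 0" "\<And>l x :: real. l \<ge> 1 \<Longrightarrow>
    \<bar>?A (2 / 3 * l) x - sqrt (2 / 3 * l) * exp (- pi * (2 / 3 * l) / 4) * (\<Sum>m\<in>{- 2..<2}. ?f l x m)\<bar>
      \<le> C * sqrt (2 / 3 * l) * exp (- pi * (2 / 3 * l) / 4) * exp (- l * (pi * (2 / 3) * real_of_int (2\<^sup>2 + 2)))"
    by (rule alternating_gaussian_sum_truncation[of "2 / 3" 2]) auto
  \<comment> \<open>The indices \<open>- 1\<close> and \<open>0\<close> have exponent 0 and cosine
    \<open>sqrt 3 / 2\<close> each, so the sum is free of \<open>l\<close>; this
    \<open>sqrt 3\<close> turns \<open>sqrt (2 / 3 * l)\<close> into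
    \<open>sqrt (2 * l)\<close>.\<close>
  have sum: "(\<Sum>m\<in>{- 2..<2}. ?f l (- 1 / 6) m) = sqrt 3" for l
  proof -
    define g where "g = ?f l (- 1 / 6)"
    have "2 * pi * (real_of_int (- 2) + 1 / 2) * (- 1 / 6) = pi / 2"
      "2 * pi * (real_of_int 1 + 1 / 2) * (- 1 / 6) = - (pi / 2)"
      "2 * pi * (real_of_int (- 1) + 1 / 2) * (- 1 / 6) = pi / 6"
      "2 * pi * (real_of_int 0 + 1 / 2) * (- 1 / 6) = - (pi / 6)"
      by simp_all
    then have "g (- 2) = 0" "g 1 = 0" "g (- 1) = sqrt 3 / 2" "g 0 = sqrt 3 / 2"
      unfolding g_def by (simp_all only: cos_minus cos_pi_half cos_30) simp_all
    moreover have "{- 2..<2 :: int} = {- 2, - 1, 0, 1}" by auto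
    ultimately show ?thesis unfolding g_def[symmetric] by simp
  qed
  show ?thesis
  proof (intro exI[of _ "C"] conjI allI impI)
    fix l :: real assume l: "l \<ge> 1"
    let ?e = "exp (pi / (24 * l))" and ?p = "sqrt (2 / 3 * l) * exp (- pi * (2 / 3 * l) / 4)"
    have "exp (- (pi / l) * (of_int j * (3 * of_int j + 1) / 2)) = ?e * exp (- (pi / (2 / 3 * l)) * (- 1 / 6 - j)\<^sup>2)"
      for j :: int
      using l by (simp add: power2_eq_square field_simps flip: exp_add)
    then have "qpoch_inf (exp (- (pi / l))) (exp (- (pi / l))) = ?e * ?A (2 / 3 * l) (- 1 / 6)"
      using l by (subst pentagonal_number) (simp_all only: mult.left_commute[of _ ?e] infsum_cmult_right', simp)
    moreover have "\<bar>?e * ?A (2 / 3 * l) (- 1 / 6) - ?e * (?p * sqrt 3)\<bar> \<le> ?e * (C * ?p * exp (- 4 * pi * l))"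
      using C(2)[OF l, of "- 1 / 6"] unfolding sum
      by (intro abs_mult_diff_le) (simp_all add: mult_ac)
    moreover have "sqrt (2 * l) * exp (pi / (24 * l) - pi * l / 6) = ?e * (?p * sqrt 3)"
    proof -
      have "sqrt (2 * l) = sqrt (2 / 3 * l) * sqrt 3" by (simp flip: real_sqrt_mult)
      moreover have "exp (pi / (24 * l) - pi * l / 6) = ?e * exp (- pi * (2 / 3 * l) / 4)"
        by (simp flip: exp_add)
      ultimately show ?thesis by (simp only: mult_ac)
    qed
    \<comment> \<open>The claimed error is relative to \<open>?p * sqrt 3\<close>, so a factor
      \<open>sqrt 3 \<ge> 1\<close> is inserted.\<close>
    moreover have "?e * (C * ?p * exp (- 4 * pi * l)) \<le> sqrt 3 * (?e * (C * ?p * exp (- 4 * pi * l)))"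
      using C(1) l by (intro mult_le_cancel_right1[THEN iffD2]) (auto simp: not_less)
    ultimately show "\<bar>qpoch_inf (exp (- pi / l)) (exp (- pi / l)) - sqrt (2 * l) * exp (pi / (24 * l) - pi * l / 6)\<bar>
      \<le> C * (sqrt (2 * l) * exp (pi / (24 * l) - pi * l / 6)) * exp (- 4 * pi * l)"
      by (simp only: minus_divide_left mult_ac)
  qed (use C in simp)
qed

subsection \<open>Asymptotics of Ramanujan's entire function\<close>

text \<open>The factor \<open>(q\<^bsup>k+1\<^esup>;q)\<^sub>\<infinity>\<close> is \<open>1 + O(q\<^sup>n/(1 - q))\<close> for \<open>k \<ge> n\<close>, and for \<open>k < n\<close> half of the
  Gaussian exponent already yields \<open>exp (-a n\<^sup>2/8)\<close> since the centre \<open>x\<close> has distance at least \<open>n/2\<close>.\<close>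

lemma qpoch_gaussian_sum_approx:
  fixes a x q :: real and w :: "int \<Rightarrow> real" and n :: nat
  assumes a: "a > 0" and q: "0 < q" "q < 1" and w: "\<And>j. \<bar>w j\<bar> \<le> 1" and x: "3 / 2 * real n \<le> x"
  shows "\<bar>(\<Sum>k. w (int k) * qpoch_inf (q ^ (k + 1)) q * exp (- a * (x - real k)\<^sup>2))
      - (\<Sum>\<^sub>\<infinity>j. w j * exp (- a * (x - of_int j)\<^sup>2))\<bar>
    \<le> exp (- a * (real n)\<^sup>2 / 8) * (\<Sum>\<^sub>\<infinity>j::int. exp (- (a / 2) * (x - of_int j)\<^sup>2))
      + q ^ n / (1 - q) * (\<Sum>\<^sub>\<infinity>j::int. exp (- a * (x - of_int j)\<^sup>2))"
proof -
  define g where "g j = exp (- a * (x - real_of_int j)\<^sup>2)" for j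
  define g2 where "g2 j = exp (- (a / 2) * (x - real_of_int j)\<^sup>2)" for j
  \<comment> \<open>The value 0 for negative \<open>j\<close> extends the one-sided series to all
    integers; the missing terms then count as a defect \<open>1 - Q j = 1\<close>, covered by the
    case \<open>j < n\<close>.\<close>
  define Q where "Q j = (if j \<ge> 0 then qpoch_inf (q ^ (nat j + 1)) q else 0)" for j
  define B where "B j = exp (- a * (real n)\<^sup>2 / 8) * g2 j + q ^ n / (1 - q) * g j" for j
  have sg: "g summable_on UNIV" and sg2: "g2 summable_on UNIV"
    unfolding g_def g2_def using a by (intro summable_on_gaussian; simp)+
  have Q: "0 \<le> Q j" "Q j \<le> 1" for j
    using qpoch_inf_bounds(1,2)[of q "q ^ (nat j + 1)"] q power_le_one[of q "nat j + 1"]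
    by (auto simp: Q_def simp del: power_Suc)
  have sB: "B summable_on UNIV"
    unfolding B_def by (intro summable_on_add summable_on_cmult_right sg sg2)
  have pos: "g j \<ge> 0" "g2 j \<ge> 0" for j by (auto simp: g_def g2_def)
  have main: "(1 - Q j) * g j \<le> B j" for j
  proof (cases "j < int n")
    case True
    have "real n / 2 \<le> x - j" using True x by linarith
    then have "(real n / 2)\<^sup>2 \<le> (x - j)\<^sup>2" by (intro power_mono) auto
    then have "a * (real n / 2)\<^sup>2 \<le> a * (x - j)\<^sup>2" using a by (intro mult_left_mono) auto
    then have "g j \<le> exp (- a * (real n)\<^sup>2 / 8) * g2 j"
      by (simp add: g_def g2_def power_divide algebra_simps flip: exp_add)
    moreover have "(1 - Q j) * g j \<le> g j"
      using Q[of j] pos[of j] by (intro mult_left_le_one_le) auto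
    moreover have "0 \<le> q ^ n / (1 - q) * g j" using q pos[of j] by auto
    ultimately show ?thesis by (simp add: B_def)
  next
    case False
    have "1 - Q j \<le> q ^ (nat j + 1) / (1 - q)"
      using qpoch_inf_bounds(3)[of q "q ^ (nat j + 1)"] q power_le_one[of q "nat j + 1"] False
      by (simp add: Q_def)
    also have "\<dots> \<le> q ^ n / (1 - q)"
      using q False by (intro divide_right_mono power_decreasing) auto
    finally have "(1 - Q j) * g j \<le> q ^ n / (1 - q) * g j"
      using pos[of j] by (intro mult_right_mono)
    moreover have "0 \<le> exp (- a * (real n)\<^sup>2 / 8) * g2 j" using pos[of j] by auto
    ultimately show ?thesis by (simp add: B_def)
  qed
  have s1: "(\<lambda>j. w j * g j) summable_on UNIV"
  proof (rule abs_summable_summable, rule summable_on_comparison_test[OF sg])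
    show "norm (w j * g j) \<le> g j" for j
      using w[of j] pos[of j] by (simp add: abs_mult mult_left_le_one_le)
  qed auto
  have s2: "(\<lambda>j. w j * Q j * g j) summable_on UNIV"
  proof (rule abs_summable_summable, rule summable_on_comparison_test[OF sg])
    show "norm (w j * Q j * g j) \<le> g j" for j
      using w[of j] Q[of j] pos[of j] by (auto simp: abs_mult intro!: mult_left_le_one_le mult_le_one)
  qed auto
  have "((\<lambda>j. w j * Q j * g j) has_sum (\<Sum>\<^sub>\<infinity>j. w j * Q j * g j)) UNIV"
    by (rule has_sum_infsum[OF s2])
  then have "((\<lambda>j. w j * Q j * g j) has_sum (\<Sum>\<^sub>\<infinity>j. w j * Q j * g j)) (range int)"
  proof (rule has_sum_cong_neutral[THEN iffD1, rotated -1])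
    fix j assume "j \<in> UNIV - range int"
    then have "j < 0" by (metis DiffD2 nonneg_int_cases not_le rangeI)
    then show "w j * Q j * g j = 0" by (simp add: Q_def)
  qed auto
  then have "((\<lambda>k. w (int k) * Q (int k) * g (int k)) has_sum (\<Sum>\<^sub>\<infinity>j. w j * Q j * g j)) UNIV"
    by (subst (asm) has_sum_reindex) (auto simp: o_def)
  moreover have "w (int k) * Q (int k) * g (int k) = w (int k) * qpoch_inf (q ^ (k + 1)) q * exp (- a * (x - real k)\<^sup>2)" for k
    by (simp add: Q_def g_def)
  ultimately have "((\<lambda>k. w (int k) * qpoch_inf (q ^ (k + 1)) q * exp (- a * (x - real k)\<^sup>2))
      has_sum (\<Sum>\<^sub>\<infinity>j. w j * Q j * g j)) UNIV"
    by (simp only:)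
  then have 1: "(\<Sum>k. w (int k) * qpoch_inf (q ^ (k + 1)) q * exp (- a * (x - real k)\<^sup>2))
      = (\<Sum>\<^sub>\<infinity>j. w j * Q j * g j)"
    by (rule sums_unique[OF has_sum_imp_sums, symmetric])
  have 2: "norm ((\<Sum>\<^sub>\<infinity>j. w j * Q j * g j) + - (\<Sum>\<^sub>\<infinity>j. w j * g j)) \<le> infsum B UNIV"
  proof (rule norm_infsum_le[OF has_sum_add[OF has_sum_infsum[OF s2]] has_sum_infsum[OF sB]])
    show "((\<lambda>j. - (w j * g j)) has_sum - (\<Sum>\<^sub>\<infinity>j. w j * g j)) UNIV"
      using has_sum_infsum[OF s1] by (simp only: has_sum_uminus minus_minus)
    fix j
    have "w j * Q j * g j + - (w j * g j) = - (w j * ((1 - Q j) * g j))"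
      by (simp add: algebra_simps)
    then have "norm (w j * Q j * g j + - (w j * g j)) = \<bar>w j\<bar> * ((1 - Q j) * g j)"
      using Q[of j] pos[of j] by (simp add: abs_mult)
    also have "\<dots> \<le> (1 - Q j) * g j"
      using w[of j] Q[of j] pos[of j] by (intro mult_left_le_one_le) auto
    also note main
    finally show "norm (w j * Q j * g j + - (w j * g j)) \<le> B j" .
  qed
  have 3: "infsum B UNIV = exp (- a * (real n)\<^sup>2 / 8) * infsum g2 UNIV + q ^ n / (1 - q) * infsum g UNIV"
    unfolding B_def
    by (simp only: infsum_add[OF summable_on_cmult_right[OF sg2] summable_on_cmult_right[OF sg]] infsum_cmult_right')
  show ?thesis
    using 2 unfolding 1 3 by (simp only: real_norm_def g_def[abs_def] g2_def[abs_def] diff_conv_add_uminus)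
qed

text \<open>\<open>s = 1\<close> and \<open>s = - 1\<close> give the two arguments of the theorem;
  the sign in front of \<open>s\<close> cancels against the \<open>- w\<close> of the series,
  leaving \<open>s ^ k\<close>.\<close>

lemma ramanujan_Aq_gaussian:
  fixes l v s :: real and n :: nat
  assumes l: "l > 0" and s: "\<bar>s\<bar> \<le> 1"
  defines "q \<equiv> exp (- pi / l)"
  shows "ramanujan_Aq q (- (s * (q powi (- 4 * int n) * exp (2 * pi * v))))
    = exp (pi * l * (v + 2 * real n / l)\<^sup>2) / qpoch_inf q q
      * (\<Sum>k. s ^ k * qpoch_inf (q ^ (k + 1)) q * exp (- (pi / l) * (2 * real n + l * v - real k)\<^sup>2))"
proof -
  define X where "X = 2 * real n + l * v"
  let ?E = "exp (pi * l * (v + 2 * real n / l)\<^sup>2)"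
  have qn: "q powi (- 4 * int n) = exp (4 * pi * real n / l)"
  proof -
    have "q powi (- 4 * int n) = q powi (- int (4 * n))" by simp
    also have "\<dots> = inverse (q ^ (4 * n))"
      by (simp only: power_int_minus power_int_of_nat)
    also have "\<dots> = exp (4 * pi * real n / l)"
      by (simp add: q_def exp_of_nat_mult[symmetric] exp_minus[symmetric])
    finally show ?thesis .
  qed
  have "qpoch_inf (q ^ (k + 1)) q * q ^ (k\<^sup>2) * (- (- (s * (q powi (- 4 * int n) * exp (2 * pi * v))))) ^ k
     = ?E * (s ^ k * qpoch_inf (q ^ (k + 1)) q * exp (- (pi / l) * (X - real k)\<^sup>2))" for k
  proof -
    have "q ^ (k\<^sup>2) * (exp (4 * pi * real n / l) * exp (2 * pi * v)) ^ k
        = exp (real (k\<^sup>2) * (- pi / l) + real k * (4 * pi * real n / l + 2 * pi * v))"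
      by (simp only: q_def exp_of_nat_mult exp_add)
    also have "real (k\<^sup>2) * (- pi / l) + real k * (4 * pi * real n / l + 2 * pi * v)
        = pi * l * (v + 2 * real n / l)\<^sup>2 + - (pi / l) * (X - real k)\<^sup>2"
      using l by (simp add: X_def power2_eq_square field_simps)
    finally have "q ^ (k\<^sup>2) * (exp (4 * pi * real n / l) * exp (2 * pi * v)) ^ k
        = ?E * exp (- (pi / l) * (X - real k)\<^sup>2)"
      by (simp only: exp_add)
    then show ?thesis
      unfolding qn minus_minus power_mult_distrib[of s] by (simp only: mult_ac)
  qed
  moreover have "summable (\<lambda>k. s ^ k * qpoch_inf (q ^ (k + 1)) q * exp (- (pi / l) * (X - real k)\<^sup>2))"
  proof (rule summable_comparison_test')
    have "(\<lambda>j::int. exp (- (pi / l) * (X - j)\<^sup>2)) summable_on range int"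
      using l by (intro summable_on_subset[OF summable_on_gaussian]) auto
    then show "summable (\<lambda>k. exp (- (pi / l) * (X - real k)\<^sup>2))"
      by (subst (asm) summable_on_reindex) (auto simp: o_def intro: summable_on_imp_summable)
    fix k
    have "0 < q" "q < 1" using l by (auto simp: q_def)
    then have "0 \<le> qpoch_inf (q ^ (k + 1)) q" "qpoch_inf (q ^ (k + 1)) q \<le> 1"
      using qpoch_inf_bounds(1,2)[of q "q ^ (k + 1)"] power_le_one[of q "k + 1"] by auto
    moreover have "\<bar>s ^ k\<bar> \<le> 1" using s by (simp add: power_abs power_le_one)
    ultimately have "\<bar>s ^ k\<bar> * \<bar>qpoch_inf (q ^ (k + 1)) q\<bar> \<le> 1"
      by (intro mult_le_one) auto
    then show "norm (s ^ k * qpoch_inf (q ^ (k + 1)) q * exp (- (pi / l) * (X - real k)\<^sup>2))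
        \<le> exp (- (pi / l) * (X - real k)\<^sup>2)"
      unfolding real_norm_def abs_mult abs_exp_cancel by (intro mult_left_le_one_le) auto
  qed
  ultimately show ?thesis
    unfolding ramanujan_Aq_def X_def[symmetric] by (simp only: suminf_mult) simp
qed

text \<open>The two thresholds give
  \<open>\<bar>l * v\<bar> \<le> 4 * l\<^sup>2 \<le> n / 2\<close>, so the centre is at least
  \<open>3 / 2 * n\<close>. The weight \<open>w\<close> stays arbitrary to serve the plain and the
  alternating sum at once.\<close>

lemma truncated_gaussian_sum_bound:
  "\<exists>C\<ge>0. \<forall>(l::real) (v::real) (n::nat) (w :: int \<Rightarrow> real).
    l \<ge> 1 \<longrightarrow> 8 * l\<^sup>2 \<le> real n \<longrightarrow> \<bar>v\<bar> \<le> 4 * l \<longrightarrow> (\<forall>j. \<bar>w j\<bar> \<le> 1) \<longrightarrow>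
    \<bar>(\<Sum>k. w (int k) * qpoch_inf (exp (- pi / l) ^ (k + 1)) (exp (- pi / l))
          * exp (- (pi / l) * (2 * real n + l * v - real k)\<^sup>2))
      - (\<Sum>\<^sub>\<infinity>j. w j * exp (- (pi / l) * (2 * real n + l * v - of_int j)\<^sup>2))\<bar>
    \<le> C * sqrt l * exp (- 3 * pi * l)"
proof -
  obtain C where C: "C \<ge> 0" "\<And>l x :: real. l \<ge> 1 \<Longrightarrow>
    \<bar>(\<Sum>\<^sub>\<infinity>j::int. exp (- (pi / l) * (x - j)\<^sup>2)) - sqrt l\<bar> \<le> C * sqrt l * exp (- pi * l)"
    using gaussian_sum_asymptotic by blast
  have G: "(\<Sum>\<^sub>\<infinity>j::int. exp (- (pi / l) * (x - j)\<^sup>2)) \<le> (1 + C) * sqrt l" if l: "l \<ge> 1" for l x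
  proof -
    have "C * sqrt l * exp (- pi * l) \<le> C * sqrt l * 1"
      using l C(1) by (intro mult_left_mono) auto
    then show ?thesis using C(2)[OF l, of x] by (simp add: distrib_right)
  qed
  show ?thesis
  \<comment> \<open>The flatter Gaussian sum contributes \<open>2 * (1 + C)\<close>, by
    \<open>sqrt (2 * l) \<le> 2 * sqrt l\<close>, and the other one \<open>1 + C\<close>.\<close>
  proof (intro exI[of _ "3 * (1 + C)"] conjI allI impI)
    fix l v :: real and n :: nat and w :: "int \<Rightarrow> real"
    assume l: "l \<ge> 1" and n: "8 * l\<^sup>2 \<le> real n" and v: "\<bar>v\<bar> \<le> 4 * l" and w: "\<forall>j. \<bar>w j\<bar> \<le> 1"
    define q where "q = exp (- pi / l)"
    define x where "x = 2 * real n + l * v"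
    have q: "0 < q" "q < 1" using l by (auto simp: q_def)
    have "\<bar>l * v\<bar> \<le> l * (4 * l)"
      unfolding abs_mult using l v by (intro mult_mono) auto
    then have x: "3 / 2 * real n \<le> x" using n by (simp add: x_def power2_eq_square)
    have nl: "8 * l \<le> real n / l"
      using n l by (simp add: field_simps power2_eq_square)
    have e1: "exp (- (pi / l) * (real n)\<^sup>2 / 8) \<le> exp (- 3 * pi * l)"
    proof -
      define r where "r = real n / l * real n"
      have "8 * l * (8 * l) \<le> r"
        unfolding r_def
      proof (rule mult_mono[OF nl])
        show "8 * l \<le> real n" using n l self_le_power[of l 2] by simp
      qed (use l in auto)
      moreover have "l * 1 \<le> l * l" using l by (intro mult_left_mono) auto
      moreover have "(real n)\<^sup>2 / (8 * l) = r / 8" by (simp add: r_def power2_eq_square)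
      ultimately have "3 * l \<le> (real n)\<^sup>2 / (8 * l)" using l by linarith
      then have "pi * (3 * l) \<le> pi * ((real n)\<^sup>2 / (8 * l))" by (intro mult_left_mono) auto
      then show ?thesis by (simp add: mult_ac)
    qed
    \<comment> \<open>\<open>1 / (1 - q)\<close> grows only linearly in \<open>l\<close>, so the
      crude bound \<open>exp l\<close> is affordable next to
      \<open>q ^ n \<le> exp (- 8 * pi * l)\<close>.\<close>
    have e2: "q ^ n / (1 - q) \<le> exp (- 3 * pi * l)"
    proof -
      have "1 + pi / l \<le> exp (pi / l)" by (rule exp_ge_add_one_self)
      moreover have "0 < 1 + pi / l" using l by (intro add_pos_pos) auto
      ultimately have "1 / exp (pi / l) \<le> 1 / (1 + pi / l)"
        by (intro divide_left_mono) auto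
      then have "q \<le> 1 / (1 + pi / l)"
        by (simp add: q_def exp_minus inverse_eq_divide)
      moreover have "1 - 1 / (1 + pi / l) = pi / (l + pi)"
        using l pi_gt_zero add_pos_pos[of l pi] by (simp add: field_simps)
      ultimately have "pi / (l + pi) \<le> 1 - q" by linarith
      then have "1 / (1 - q) \<le> 1 / (pi / (l + pi))"
        using l q by (intro divide_left_mono) (auto intro!: mult_pos_pos divide_pos_pos add_pos_pos)
      also have "\<dots> = 1 + l / pi" by (simp add: field_simps)
      also have "\<dots> \<le> 1 + l" using l pi_ge_two by (simp add: field_simps)
      also have "\<dots> \<le> exp l" by simp
      finally have "1 / (1 - q) \<le> exp l" .
      moreover have "q ^ n \<le> exp (- 8 * pi * l)"
      proof -
        have "q ^ n = exp (- pi * (real n / l))"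
          by (simp add: q_def exp_of_nat_mult[symmetric] mult.commute)
        then show ?thesis using mult_left_mono[OF nl, of pi] by (simp add: mult_ac)
      qed
      ultimately have "q ^ n * (1 / (1 - q)) \<le> exp (- 8 * pi * l) * exp l"
        using q by (intro mult_mono) auto
      also have "l \<le> pi * l" using l pi_ge_two by simp
      then have "exp (- 8 * pi * l) * exp l \<le> exp (- 3 * pi * l)"
        unfolding exp_add[symmetric] exp_le_cancel_iff using l by (simp add: mult.assoc)
      finally show ?thesis by simp
    qed
    have s2: "(\<Sum>\<^sub>\<infinity>j::int. exp (- ((pi / l) / 2) * (x - j)\<^sup>2)) \<le> 2 * ((1 + C) * sqrt l)"
    proof -
      have "(1 + C) * sqrt (2 * l) \<le> (1 + C) * (2 * sqrt l)"
        using C(1) l by (intro mult_left_mono real_le_lsqrt) (auto simp: power_mult_distrib)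
      then show ?thesis using G[of "2 * l" x] l by (simp add: mult_ac)
    qed
    have "\<bar>(\<Sum>k. w (int k) * qpoch_inf (q ^ (k + 1)) q * exp (- (pi / l) * (x - real k)\<^sup>2))
        - (\<Sum>\<^sub>\<infinity>j. w j * exp (- (pi / l) * (x - of_int j)\<^sup>2))\<bar>
      \<le> exp (- (pi / l) * (real n)\<^sup>2 / 8) * (\<Sum>\<^sub>\<infinity>j::int. exp (- ((pi / l) / 2) * (x - of_int j)\<^sup>2))
        + q ^ n / (1 - q) * (\<Sum>\<^sub>\<infinity>j::int. exp (- (pi / l) * (x - of_int j)\<^sup>2))"
      using l w by (intro qpoch_gaussian_sum_approx q x) auto
    also have "\<dots> \<le> exp (- 3 * pi * l) * (2 * ((1 + C) * sqrt l)) + exp (- 3 * pi * l) * ((1 + C) * sqrt l)"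
      by (intro add_mono mult_mono e1 e2 s2 G[OF l] infsum_nonneg) auto
    also have "\<dots> = 3 * (1 + C) * sqrt l * exp (- 3 * pi * l)"
      by (simp add: algebra_simps)
    finally show "\<bar>(\<Sum>k. w (int k) * qpoch_inf (exp (- pi / l) ^ (k + 1)) (exp (- pi / l))
          * exp (- (pi / l) * (2 * real n + l * v - real k)\<^sup>2))
      - (\<Sum>\<^sub>\<infinity>j. w j * exp (- (pi / l) * (2 * real n + l * v - of_int j)\<^sup>2))\<bar>
      \<le> 3 * (1 + C) * sqrt l * exp (- 3 * pi * l)"
      by (simp only: q_def x_def)
  qed (use C in auto)
qed

section \<open>Division by Euler's product and passage to the scale\<close>

text \<open>With \<open>T = \<tau> * (c + \<epsilon>)\<close> and
  \<open>P = p * (1 + \<delta>)\<close> the difference is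
  \<open>(\<epsilon> - c * \<delta>) / (1 + \<delta>)\<close>, and \<open>d \<le> 1 / 2\<close>
  keeps the denominator at least \<open>1 / 2\<close>. The error is added to \<open>c\<close> and
  does not multiply it, since the cosine put for \<open>c\<close> may vanish.\<close>

lemma abs_quotient_diff_le:
  fixes P p T \<tau> c d e :: real
  assumes P: "\<bar>P - p\<bar> \<le> p * d" "p > 0" "d \<le> 1 / 2"
    and T: "\<bar>T - \<tau> * c\<bar> \<le> \<tau> * e" "\<tau> > 0" and c: "\<bar>c\<bar> \<le> 1"
  shows "\<bar>T / \<tau> / (P / p) - c\<bar> \<le> 2 * (e + d)"
proof -
  define \<delta> where "\<delta> = P / p - 1"
  define \<epsilon> where "\<epsilon> = T / \<tau> - c"
  have "P - p = p * \<delta>" "T - \<tau> * c = \<tau> * \<epsilon>"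
    using P T by (simp_all add: \<delta>_def \<epsilon>_def right_diff_distrib)
  then have \<delta>: "\<bar>\<delta>\<bar> \<le> d" and \<epsilon>: "\<bar>\<epsilon>\<bar> \<le> e"
    using P T by (simp_all add: abs_mult)
  have pos: "1 + \<delta> \<ge> 1 / 2" using \<delta> P by linarith
  have "T / \<tau> = c + \<epsilon>" "P / p = 1 + \<delta>" by (simp_all add: \<delta>_def \<epsilon>_def)
  then have "T / \<tau> / (P / p) - c = (\<epsilon> - c * \<delta>) / (1 + \<delta>)"
    using pos by (simp add: field_simps)
  also have "\<bar>\<dots>\<bar> = \<bar>\<epsilon> - c * \<delta>\<bar> / (1 + \<delta>)" using pos by simp
  also have "\<dots> \<le> (e + d) / (1 / 2)"
  proof (rule frac_le)
    have "\<bar>c * \<delta>\<bar> \<le> 1 * d" unfolding abs_mult using c \<delta> by (intro mult_mono) auto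
    then show "\<bar>\<epsilon> - c * \<delta>\<bar> \<le> e + d" using \<epsilon> by linarith
    show "0 \<le> e + d" using \<epsilon> \<delta> by linarith
  qed (use pos in auto)
  finally show ?thesis by simp
qed

lemma ramanujan_Aq_uniform_asymptotic:
  "\<exists>C L. L \<ge> 1 \<and> (\<forall>(l::real) (v::real) (n::nat). l \<ge> L \<longrightarrow> 8 * l\<^sup>2 \<le> real n \<longrightarrow> \<bar>v\<bar> \<le> 4 * l \<longrightarrow>
     \<bar>ramanujan_Aq (exp (- pi / l)) (- (exp (- pi / l) powi (- 4 * int n) * exp (2 * pi * v)))
        / (exp (pi * l * (v + 2 * real n / l)\<^sup>2 + pi * l / 6 - pi / (24 * l)) * (1 / sqrt 2)) - 1\<bar>
       \<le> C * exp (- pi * l) \<and>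
     \<bar>ramanujan_Aq (exp (- pi / l)) (exp (- pi / l) powi (- 4 * int n) * exp (2 * pi * v))
        / (exp (pi * l * (v + 2 * real n / l)\<^sup>2 - pi * l / 12 - pi / (24 * l)) * sqrt 2) - cos (pi * l * v)\<bar>
       \<le> C * exp (- 2 * pi * l))"
proof -
  obtain C1 where C1: "C1 \<ge> 0" "\<And>l x :: real. l \<ge> 1 \<Longrightarrow>
    \<bar>(\<Sum>\<^sub>\<infinity>j::int. exp (- (pi / l) * (x - j)\<^sup>2)) - sqrt l\<bar> \<le> C1 * sqrt l * exp (- pi * l)"
    using gaussian_sum_asymptotic by blast
  obtain C2 where C2: "C2 \<ge> 0" "\<And>l x :: real. l \<ge> 1 \<Longrightarrow>
    \<bar>(\<Sum>\<^sub>\<infinity>j::int. (if even j then 1 else - 1) * exp (- (pi / l) * (x - j)\<^sup>2))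
      - 2 * sqrt l * exp (- pi * l / 4) * cos (pi * x)\<bar>
    \<le> C2 * sqrt l * exp (- pi * l / 4) * exp (- 2 * pi * l)"
    using alternating_gaussian_sum_asymptotic by blast
  obtain C3 where C3: "C3 \<ge> 0" "\<And>l :: real. l \<ge> 1 \<Longrightarrow>
    \<bar>qpoch_inf (exp (- pi / l)) (exp (- pi / l)) - sqrt (2 * l) * exp (pi / (24 * l) - pi * l / 6)\<bar>
    \<le> C3 * (sqrt (2 * l) * exp (pi / (24 * l) - pi * l / 6)) * exp (- 4 * pi * l)"
    using qpoch_inf_asymptotic by blast
  obtain C4 where C4: "C4 \<ge> 0" "\<And>(l::real) (v::real) (n::nat) (w :: int \<Rightarrow> real).
    l \<ge> 1 \<Longrightarrow> 8 * l\<^sup>2 \<le> real n \<Longrightarrow> \<bar>v\<bar> \<le> 4 * l \<Longrightarrow> (\<And>j. \<bar>w j\<bar> \<le> 1) \<Longrightarrow>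
    \<bar>(\<Sum>k. w (int k) * qpoch_inf (exp (- pi / l) ^ (k + 1)) (exp (- pi / l))
          * exp (- (pi / l) * (2 * real n + l * v - real k)\<^sup>2))
      - (\<Sum>\<^sub>\<infinity>j. w j * exp (- (pi / l) * (2 * real n + l * v - of_int j)\<^sup>2))\<bar>
    \<le> C4 * sqrt l * exp (- 3 * pi * l)"
    using truncated_gaussian_sum_bound by blast
  define C where "C = 2 * (C1 + C2 + C4 + C3)"
  \<comment> \<open>\<open>l \<ge> 2 * C3\<close> makes the relative error \<open>d\<close> of the
    product at most \<open>1 / 2\<close>, by \<open>1 + l \<le> exp l\<close>.\<close>
  define L where "L = max 1 (2 * C3)"
  show ?thesis
  proof (rule exI[of _ C], rule exI[of _ L], intro conjI allI impI)
    show "L \<ge> 1" by (simp add: L_def)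
    fix l v :: real and n :: nat
    assume L: "l \<ge> L" and n: "8 * l\<^sup>2 \<le> real n" and v: "\<bar>v\<bar> \<le> 4 * l"
    have l: "l \<ge> 1" using L by (simp add: L_def)
    define q where "q = exp (- pi / l)"
    define X where "X = 2 * real n + l * v"
    define S where "S = exp (pi * l * (v + 2 * real n / l)\<^sup>2)"
    define P where "P = qpoch_inf q q"
    define p where "p = sqrt (2 * l) * exp (pi / (24 * l) - pi * l / 6)"
    define d where "d = C3 * exp (- 4 * pi * l)"
    define T where "T s = (\<Sum>k. s ^ k * qpoch_inf (q ^ (k + 1)) q * exp (- (pi / l) * (X - real k)\<^sup>2))" for s
    have A: "ramanujan_Aq q (- (s * (q powi (- 4 * int n) * exp (2 * pi * v)))) = S / P * T s"
      if "\<bar>s\<bar> \<le> 1" for s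
      using ramanujan_Aq_gaussian[of l s n v] l that
      by (simp only: q_def S_def P_def T_def X_def)
    have p: "p > 0" using l by (simp add: p_def)
    have P: "\<bar>P - p\<bar> \<le> p * d"
      using C3(2)[OF l] by (simp add: P_def p_def q_def d_def mult_ac)
    have mono: "exp (- x * pi * l) \<le> exp (- y * pi * l)" if "y \<le> x" for x y
      using that l by (simp add: mult_right_mono)
    have "d \<le> 1 / 2"
    proof -
      have "C3 * 2 \<le> 1 + l" using L by (simp add: L_def)
      also have "\<dots> \<le> exp l" by simp
      also have "\<dots> \<le> exp (4 * pi * l)" using l pi_ge_two by simp
      finally show ?thesis by (simp add: d_def exp_minus field_simps)
    qed
    note quot = abs_quotient_diff_le[OF P p this]
    have d1: "d \<le> C3 * exp (- 1 * pi * l)" and d2: "d \<le> C3 * exp (- 2 * pi * l)"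
      unfolding d_def using C3(1) by (intro mult_left_mono mono; simp)+
    have "\<bar>T 1 - sqrt l * 1\<bar> \<le> sqrt l * ((C1 + C4) * exp (- 1 * pi * l))"
    proof -
      have "\<bar>T 1 - (\<Sum>\<^sub>\<infinity>j::int. exp (- (pi / l) * (X - of_int j)\<^sup>2))\<bar> \<le> C4 * sqrt l * exp (- 3 * pi * l)"
        using C4(2)[OF l n v, of "\<lambda>_. 1"] by (simp add: T_def X_def q_def)
      also have "\<dots> \<le> C4 * sqrt l * exp (- 1 * pi * l)"
        using C4(1) l by (intro mult_left_mono mono) auto
      finally show ?thesis
        using C1(2)[OF l, of X] by (simp add: algebra_simps)
    qed
    from quot[OF this] l
    have "\<bar>T 1 / sqrt l / (P / p) - 1\<bar> \<le> 2 * ((C1 + C4) * exp (- 1 * pi * l) + d)" by simp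
    also have "\<dots> \<le> C * exp (- pi * l)"
      using d1 mult_nonneg_nonneg[OF C2(1), of "exp (- 1 * pi * l)"] by (simp add: C_def algebra_simps)
    also have "T 1 / sqrt l / (P / p) = S / P * T 1 / (S * exp (pi * l / 6 - pi / (24 * l)) * (1 / sqrt 2))"
      using l by (simp add: p_def S_def real_sqrt_mult exp_diff)
    finally show "\<bar>ramanujan_Aq (exp (- pi / l)) (- (exp (- pi / l) powi (- 4 * int n) * exp (2 * pi * v)))
        / (exp (pi * l * (v + 2 * real n / l)\<^sup>2 + pi * l / 6 - pi / (24 * l)) * (1 / sqrt 2)) - 1\<bar>
       \<le> C * exp (- pi * l)"
      using A[of 1] by (simp add: q_def S_def add_diff_eq flip: exp_add)
    define \<tau> where "\<tau> = 2 * sqrt l * exp (- pi * l / 4)"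
    have "\<tau> > 0" using l by (simp add: \<tau>_def)
    \<comment> \<open>\<open>X\<close> and \<open>l * v\<close> differ by the even integer
      \<open>2 * n\<close>, so the exponent \<open>4 * n\<close> of \<open>q\<close> leaves the
      cosine free of \<open>n\<close>.\<close>
    have cX: "cos (pi * X) = cos (pi * l * v)"
    proof -
      have "pi * X = pi * l * v + 2 * real n * pi" by (simp add: X_def algebra_simps)
      then show ?thesis by (simp only: cos_add cos_2npi sin_2npi)
    qed
    have "\<bar>T (- 1) - \<tau> * cos (pi * l * v)\<bar> \<le> \<tau> * ((C2 + C4) * exp (- 2 * pi * l))"
    proof -
      have "(if even (int k) then 1 else - 1) = (- 1 :: real) ^ k" for k
        by (simp add: minus_one_power_iff)
      then have "\<bar>T (- 1) - (\<Sum>\<^sub>\<infinity>j::int. (if even j then 1 else - 1) * exp (- (pi / l) * (X - of_int j)\<^sup>2))\<bar>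
          \<le> C4 * sqrt l * exp (- 3 * pi * l)"
        using C4(2)[OF l n v, of "\<lambda>j. if even j then 1 else - 1"] by (simp add: T_def X_def q_def)
      also have "\<dots> \<le> C4 * sqrt l * (exp (- pi * l / 4) * exp (- 2 * pi * l))"
        using C4(1) l by (intro mult_left_mono) (auto simp flip: exp_add)
      finally have "\<bar>T (- 1) - \<tau> * cos (pi * l * v)\<bar>
          \<le> (C2 + C4) * (sqrt l * exp (- pi * l / 4) * exp (- 2 * pi * l))"
        using C2(2)[OF l, of X] unfolding cX \<tau>_def distrib_right by (simp add: mult_ac)
      \<comment> \<open>\<open>\<tau>\<close> contains a factor 2 that the bound lacks; doubling
        restores the form required by the quotient estimate.\<close>
      also have "\<dots> \<le> 2 * \<dots>" using C2(1) C4(1) l by simp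
      finally show ?thesis by (simp add: \<tau>_def mult_ac)
    qed
    from quot[OF this \<open>\<tau> > 0\<close>]
    have "\<bar>T (- 1) / \<tau> / (P / p) - cos (pi * l * v)\<bar> \<le> 2 * ((C2 + C4) * exp (- 2 * pi * l) + d)" by simp
    also have "\<dots> \<le> C * exp (- 2 * pi * l)"
      using d2 mult_nonneg_nonneg[OF C1(1), of "exp (- 2 * pi * l)"] by (simp add: C_def algebra_simps)
    also have "T (- 1) / \<tau> / (P / p) = S / P * T (- 1) / (S * exp (- pi * l / 12 - pi / (24 * l)) * sqrt 2)"
    proof -
      have "pi / (24 * l) - pi * l / 6 = - pi * l / 4 - (- pi * l / 12 - pi / (24 * l))" by simp
      then have "p = sqrt (2 * l) * (exp (- pi * l / 4) / exp (- pi * l / 12 - pi / (24 * l)))"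
        unfolding p_def by (simp only: exp_diff)
      moreover have "sqrt (2 * l) / 2 = sqrt l / sqrt 2"
        by (simp add: real_sqrt_mult field_simps)
      ultimately have "p / \<tau> = 1 / (exp (- pi * l / 12 - pi / (24 * l)) * sqrt 2)"
        using l by (simp add: \<tau>_def field_simps)
      moreover have "T (- 1) / \<tau> / (P / p) = T (- 1) / P * (p / \<tau>)" by simp
      ultimately show ?thesis
        by (simp add: S_def)
    qed
    finally show "\<bar>ramanujan_Aq (exp (- pi / l)) (exp (- pi / l) powi (- 4 * int n) * exp (2 * pi * v))
        / (exp (pi * l * (v + 2 * real n / l)\<^sup>2 - pi * l / 12 - pi / (24 * l)) * sqrt 2) - cos (pi * l * v)\<bar>
       \<le> C * exp (- 2 * pi * l)"
      using A[of "- 1"] by (simp add: q_def S_def add_diff_eq flip: exp_add)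
  qed
qed

text \<open>Eventually \<open>ln n \<le> l n\<close> because the quotient is at least 1, so
  \<open>l n\<close> outgrows every \<open>B\<close>; positivity of \<open>l n\<close> clears the
  denominator in the second limit.\<close>

lemma admissible_scale_eventually:
  assumes "admissible_scale l"
  shows "\<forall>\<^sub>F n in sequentially. B \<le> l n \<and> 8 * (l n)\<^sup>2 \<le> real n"
proof -
  have pos: "l n > 0" if "n \<ge> 1" for n
    using assms that by (simp add: admissible_scale_def)
  have "\<forall>\<^sub>F n in sequentially. 1 \<le> l n / ln (real n)"
    using assms by (simp add: admissible_scale_def filterlim_at_top)
  moreover have "\<forall>\<^sub>F n in sequentially. 8 \<le> real n / (l n)\<^sup>2"
    using assms by (simp add: admissible_scale_def filterlim_at_top)
  moreover have "filterlim (\<lambda>n. ln (real n)) at_top sequentially"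
    by (rule filterlim_compose[OF ln_at_top filterlim_real_sequentially])
  then have "\<forall>\<^sub>F n in sequentially. max 1 B \<le> ln (real n)"
    by (simp only: filterlim_at_top)
  ultimately show ?thesis
    using eventually_ge_at_top[of 1]
  proof eventually_elim
    case (elim n)
    then have "0 < ln (real n)" by linarith
    then have "ln (real n) \<le> l n" using elim pos_le_divide_eq[of "ln (real n)" 1 "l n"] by simp
    moreover have "8 * (l n)\<^sup>2 \<le> real n"
      using elim pos[of n] pos_le_divide_eq[of "(l n)\<^sup>2" 8 "real n"] by simp
    ultimately show ?case using elim by simp
  qed
qed

theorem corollary3:
  fixes l :: "nat \<Rightarrow> real" and q :: "nat \<Rightarrow> real" and z :: "real \<Rightarrow> real"
  assumes "admissible_scale l"
  defines "q \<equiv> \<lambda>n. exp (- pi / l n)"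
    and "z \<equiv> \<lambda>v. exp (2 * pi * v)"
  shows "\<exists>E1 E2 :: nat \<Rightarrow> real \<Rightarrow> real.
    bigo_unif_compacts E1 (\<lambda>n. exp (- pi * l n)) \<and>
    bigo_unif_compacts E2 (\<lambda>n. exp (- 2 * pi * l n)) \<and>
    (\<forall>n\<ge>1. \<forall>v.
      ramanujan_Aq (q n) (- (q n powi (- 4 * int n)) * z v) =
        exp (pi * l n * (v + 2 * real n / l n)\<^sup>2 + pi * l n / 6 - pi / (24 * l n))
          * (1 / sqrt 2) * (1 + E1 n v) \<and>
      ramanujan_Aq (q n) (q n powi (- 4 * int n) * z v) =
        exp (pi * l n * (v + 2 * real n / l n)\<^sup>2 - pi * l n / 12 - pi / (24 * l n))
          * sqrt 2 * (cos (pi * l n * v) + E2 n v))"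
proof -
  \<comment> \<open>Solving the claimed equations for the error terms makes them hold for every
    \<open>n\<close> and \<open>v\<close>, as the divisors never vanish; what remains is to bound
    the errors.\<close>
  define E1 where "E1 n v = ramanujan_Aq (q n) (- (q n powi (- 4 * int n) * z v))
    / (exp (pi * l n * (v + 2 * real n / l n)\<^sup>2 + pi * l n / 6 - pi / (24 * l n)) * (1 / sqrt 2)) - 1" for n v
  define E2 where "E2 n v = ramanujan_Aq (q n) (q n powi (- 4 * int n) * z v)
    / (exp (pi * l n * (v + 2 * real n / l n)\<^sup>2 - pi * l n / 12 - pi / (24 * l n)) * sqrt 2)
    - cos (pi * l n * v)" for n v
  obtain C L where L: "L \<ge> 1" and bound: "\<And>n v. L \<le> l n \<Longrightarrow> 8 * (l n)\<^sup>2 \<le> real n \<Longrightarrow> \<bar>v\<bar> \<le> 4 * l n \<Longrightarrow>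
      \<bar>E1 n v\<bar> \<le> C * exp (- pi * l n) \<and> \<bar>E2 n v\<bar> \<le> C * exp (- 2 * pi * l n)"
    unfolding E1_def E2_def q_def z_def using ramanujan_Aq_uniform_asymptotic by blast
  have "\<exists>N. \<forall>n\<ge>N. \<forall>v\<in>K. \<bar>E1 n v\<bar> \<le> C * exp (- pi * l n) \<and> \<bar>E2 n v\<bar> \<le> C * exp (- 2 * pi * l n)"
    if K: "compact K" for K
  proof -
    obtain V where V: "\<And>v. v \<in> K \<Longrightarrow> \<bar>v\<bar> \<le> V"
      using compact_imp_bounded[OF K] by (auto simp: bounded_iff)
    \<comment> \<open>Eventually \<open>l n\<close> is at least the radius \<open>V\<close> of
      \<open>K\<close>, so \<open>\<bar>v\<bar> \<le> 4 * l n\<close> holds on all of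
      \<open>K\<close>.\<close>
    obtain N where N: "\<And>n. n \<ge> N \<Longrightarrow> max L V \<le> l n \<and> 8 * (l n)\<^sup>2 \<le> real n"
      using admissible_scale_eventually[OF assms(1)] unfolding eventually_sequentially by blast
    show ?thesis
    proof (intro exI[of _ N] allI impI ballI)
      fix n v assume "n \<ge> N" "v \<in> K"
      with N[of n] V[of v] L show "\<bar>E1 n v\<bar> \<le> C * exp (- pi * l n) \<and> \<bar>E2 n v\<bar> \<le> C * exp (- 2 * pi * l n)"
        by (intro bound) auto
    qed
  qed
  then have "bigo_unif_compacts E1 (\<lambda>n. exp (- pi * l n))" "bigo_unif_compacts E2 (\<lambda>n. exp (- 2 * pi * l n))"
    unfolding bigo_unif_compacts_def by meson+
  moreover have "ramanujan_Aq (q n) (- (q n powi (- 4 * int n)) * z v) =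
        exp (pi * l n * (v + 2 * real n / l n)\<^sup>2 + pi * l n / 6 - pi / (24 * l n))
          * (1 / sqrt 2) * (1 + E1 n v)"
    "ramanujan_Aq (q n) (q n powi (- 4 * int n) * z v) =
        exp (pi * l n * (v + 2 * real n / l n)\<^sup>2 - pi * l n / 12 - pi / (24 * l n))
          * sqrt 2 * (cos (pi * l n * v) + E2 n v)" for n v
    by (simp_all add: E1_def E2_def)
  ultimately show ?thesis by blast
qed

end
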